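(* Let $\boldsymbol\alpha_i=(\alpha_{i,1},\ldots,\alpha_{i,k_i})$, $i=1,\ldots,n$, be spherical chains in $\mathbb H$, and let $V_m^{\boldsymbol\ell}(\boldsymbol\alpha_1,\ldots,\boldsymbol\alpha_n)$ and $V_m^{\boldsymbol r}(\boldsymbol\alpha_1,\ldots,\boldsymbol\alpha_n)$ be the left and right confluent Vandermonde matrices based on these chains. To each conjugacy class $S_j$ containing at least one of these chains assign the integer $\mu(S_j)$ (defined in the context), and let $\kappa=\sum_j\mu(S_j)$. Then $$\operatorname{rank}V_m^{\boldsymbol\ell}(\boldsymbol\alpha_1,\ldots,\boldsymbol\alpha_n)=\min(m,\kappa)=\operatorname{rank}V_m^{\boldsymbol r}(\boldsymbol\alpha_1,\ldots,\boldsymbol\alpha_n).$$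
   Context: $\mathbb H$ is the skew field of (real) quaternions. $\alpha\sim\beta$ means $\alpha=h^{-1}\beta h$ for some nonzero $h\in\mathbb H$; equivalence classes are called conjugacy classes. A spherical chain (of length $k$) is a tuple $\boldsymbol\alpha=(\alpha_1,\ldots,\alpha_k)$ with $\alpha_1\sim\cdots\sim\alpha_k$ and $\alpha_{j+1}\neq\overline{\alpha}_j$ for $j=1,\ldots,k-1$. The rank of a quaternion matrix is the dimension of the left linear span of its rows, equivalently of the right linear span of its columns. $\mathbb H[z]$ is the polynomial ring in a variable $z$ commuting with quaternion coefficients. For $f(z)=\sum_{j=0}^m z^jf_j$: left and right evaluations are $f^{\boldsymbol{e_\ell}}(\alpha)=\sum\alpha^jf_j$, $f^{\boldsymbol{e_r}}(\alpha)=\sum f_j\alpha^j$; $L_\alpha f$ and $R_\alpha f$ are the unique polynomials with $f=f^{\boldsymbol{e_\ell}}(\alpha)+(z-\alpha)\cdot L_\alpha f=f^{\boldsymbol{e_r}}(\alpha)+R_\alpha f\cdot(z-\alpha)$. Left and right divided differences: $[\alpha_1;f]_{\boldsymbol\ell}=f^{\boldsymbol{e_\ell}}(\alpha_1)$, $[\alpha_1,\ldots,\alpha_j;f]_{\boldsymbol\ell}=(L_{\alpha_{j-1}}\cdots L_{\alpha_1}f)^{\boldsymbol{e_\ell}}(\alpha_j)$ for $j\ge 2$; $[f;\alpha_1]_{\boldsymbol r}=f^{\boldsymbol{e_r}}(\alpha_1)$, $[f;\alpha_1,\ldots,\alpha_j]_{\boldsymbol r}=(R_{\alpha_{j-1}}\cdots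 R_{\alpha_1}f)^{\boldsymbol{e_r}}(\alpha_j)$ for $j\ge 2$. For one chain $\boldsymbol\alpha=(\alpha_1,\ldots,\alpha_k)$, $V_m^{\boldsymbol\ell}(\boldsymbol\alpha)$ is the $k\times m$ matrix with $(i,j)$ entry $[\alpha_1,\ldots,\alpha_i;z^{j-1}]_{\boldsymbol\ell}$, and $V_m^{\boldsymbol r}(\boldsymbol\alpha)$ is the $m\times k$ matrix with $(i,j)$ entry $[z^{i-1};\alpha_1,\ldots,\alpha_j]_{\boldsymbol r}$. $V_m^{\boldsymbol\ell}(\boldsymbol\alpha_1,\ldots,\boldsymbol\alpha_n)$ is obtained by stacking the blocks $V_m^{\boldsymbol\ell}(\boldsymbol\alpha_1),\ldots,V_m^{\boldsymbol\ell}(\boldsymbol\alpha_n)$ vertically, and $V_m^{\boldsymbol r}(\boldsymbol\alpha_1,\ldots,\boldsymbol\alpha_n)=[V_m^{\boldsymbol r}(\boldsymbol\alpha_1)\ \cdots\ V_m^{\boldsymbol r}(\boldsymbol\alpha_n)]$. Definition of $\mu(S)$: if the conjugacy class $S$ contains only one chain $\boldsymbol\alpha_i$ from the given list, $\mu(S)=k_i$. If $S$ contains at least two of the chains, pick a longest chain $\boldsymbol\alpha_i\subset S$, and for any other chain $\boldsymbol\alpha_j\subset S$ of the list let $\nu_j=0$ if $\alpha_{j,1}\ne\alpha_{i,1}$, and $\nu_j=\max\{r:\alpha_{j,\xi}=\alpha_{i,\xi}\ (1\le\xi\le r)\}$ if $\alpha_{j,1}=\alpha_{i,1}$; then $\mu(S)=k_i+\max_{j\ne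 i}\{k_j-\nu_j\}$, the maximum being over the other chains of the list in $S$. (This integer does not depend on which longest chain is chosen.) *)

theory Defs
  imports
    Complex_Main
    "HOL-Computational_Algebra.Polynomial"
    "Jordan_Normal_Form.Matrix"
begin

section \<open>The skew field of real quaternions\<close>

codatatype quat = Quat (qRe: real) (qI: real) (qJ: real) (qK: real)

lemma quat_eq_iff:
  "x = y \<longleftrightarrow> qRe x = qRe y \<and> qI x = qI y \<and> qJ x = qJ y \<and> qK x = qK y"
  by (auto intro: quat.expand)

instantiation quat :: division_ring
begin

primcorec zero_quat where
  "qRe 0 = 0" | "qI 0 = 0" | "qJ 0 = 0" | "qK 0 = 0"

primcorec one_quat where
  "qRe 1 = 1" | "qI 1 = 0" | "qJ 1 = 0" | "qK 1 = 0"

primcorec plus_quat where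
  "qRe (x + y) = qRe x + qRe y"
| "qI (x + y) = qI x + qI y"
| "qJ (x + y) = qJ x + qJ y"
| "qK (x + y) = qK x + qK y"

primcorec uminus_quat where
  "qRe (- x) = - qRe x"
| "qI (- x) = - qI x"
| "qJ (- x) = - qJ x"
| "qK (- x) = - qK x"

primcorec minus_quat where
  "qRe (x - y) = qRe x - qRe y"
| "qI (x - y) = qI x - qI y"
| "qJ (x - y) = qJ x - qJ y"
| "qK (x - y) = qK x - qK y"

primcorec times_quat where
  "qRe (x * y) = qRe x * qRe y - qI x * qI y - qJ x * qJ y - qK x * qK y"
| "qI (x * y) = qRe x * qI y + qI x * qRe y + qJ x * qK y - qK x * qJ y"
| "qJ (x * y) = qRe x * qJ y - qI x * qK y + qJ x * qRe y + qK x * qI y"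
| "qK (x * y) = qRe x * qK y + qI x * qJ y - qJ x * qI y + qK x * qRe y"

primcorec inverse_quat where
  "qRe (inverse x) = qRe x / ((qRe x)\<^sup>2 + (qI x)\<^sup>2 + (qJ x)\<^sup>2 + (qK x)\<^sup>2)"
| "qI (inverse x) = - qI x / ((qRe x)\<^sup>2 + (qI x)\<^sup>2 + (qJ x)\<^sup>2 + (qK x)\<^sup>2)"
| "qJ (inverse x) = - qJ x / ((qRe x)\<^sup>2 + (qI x)\<^sup>2 + (qJ x)\<^sup>2 + (qK x)\<^sup>2)"
| "qK (inverse x) = - qK x / ((qRe x)\<^sup>2 + (qI x)\<^sup>2 + (qJ x)\<^sup>2 + (qK x)\<^sup>2)"

definition divide_quat :: "quat \<Rightarrow> quat \<Rightarrow> quat" where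
  "divide_quat x y = x * inverse y"

instance
proof
  fix x y z :: quat
  show "x + y + z = x + (y + z)" "x + y = y + x" "0 + x = x" "- x + x = 0"
    "x - y = x + - y" "1 * x = x" "x * 1 = x" "(0::quat) \<noteq> 1"
    by (simp_all add: quat_eq_iff)
  show "x * y * z = x * (y * z)" "(x + y) * z = x * z + y * z" "x * (y + z) = x * y + x * z"
    by (simp_all add: quat_eq_iff algebra_simps)
  show "x div y = x * inverse y" by (simp add: divide_quat_def)
  show "inverse (0::quat) = 0" by (simp add: quat_eq_iff)
  let ?N = "(qRe x)\<^sup>2 + (qI x)\<^sup>2 + (qJ x)\<^sup>2 + (qK x)\<^sup>2"
  assume "x \<noteq> 0"
  then have "qRe x \<noteq> 0 \<or> qI x \<noteq> 0 \<or> qJ x \<noteq> 0 \<or> qK x \<noteq> 0"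
    by (simp add: quat_eq_iff)
  then have "?N > 0"
    using zero_le_power2[of "qRe x"] zero_le_power2[of "qI x"]
      zero_le_power2[of "qJ x"] zero_le_power2[of "qK x"]
      zero_less_power2[of "qRe x"] zero_less_power2[of "qI x"]
      zero_less_power2[of "qJ x"] zero_less_power2[of "qK x"]
    by linarith
  then have N: "?N \<noteq> 0" by simp
  have *: "a / ?N + b / ?N = (a + b) / ?N" "a / ?N - b / ?N = (a - b) / ?N" for a b :: real
    by (simp_all add: add_divide_distrib diff_divide_distrib)
  have r: "qRe x * qRe x + qI x * qI x + qJ x * qJ x + qK x * qK x = ?N"
    by (simp add: power2_eq_square)
  show "inverse x * x = 1" "x * inverse x = 1"
    by (simp_all add: quat_eq_iff * r N mult.commute)
qed

end

primcorec qcnj :: "quat \<Rightarrow> quat" where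
  "qRe (qcnj x) = qRe x"
| "qI (qcnj x) = - qI x"
| "qJ (qcnj x) = - qJ x"
| "qK (qcnj x) = - qK x"

definition qsim :: "quat \<Rightarrow> quat \<Rightarrow> bool" where
  "qsim a b \<longleftrightarrow> (\<exists>h. h \<noteq> 0 \<and> a = inverse h * b * h)"

definition conj_classes :: "quat set set" where
  "conj_classes = UNIV // {(a, b). qsim a b}"

definition spherical_chain :: "quat list \<Rightarrow> bool" where
  "spherical_chain as \<longleftrightarrow> as \<noteq> [] \<and> successively (\<lambda>a b. qsim a b \<and> b \<noteq> qcnj a) as"

section \<open>Polynomials over the quaternions\<close>

text \<open>
  Elements of \<open>\<bbbH>[z]\<close> are represented by the type \<open>quat poly\<close> of coefficient sequences with its
  additive structure.  The library product on polynomials requires commutative coefficients, so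
  the product with a central variable \<open>z\<close> is defined here.
\<close>

definition qpoly_mult :: "quat poly \<Rightarrow> quat poly \<Rightarrow> quat poly" (infixl \<open>\<otimes>\<^sub>q\<close> 70) where
  "f \<otimes>\<^sub>q g = (\<Sum>i\<le>degree f. \<Sum>j\<le>degree g. monom (coeff f i * coeff g j) (i + j))"

definition eval_left :: "quat poly \<Rightarrow> quat \<Rightarrow> quat" where
  "eval_left f a = (\<Sum>j\<le>degree f. a ^ j * coeff f j)"

definition eval_right :: "quat poly \<Rightarrow> quat \<Rightarrow> quat" where
  "eval_right f a = (\<Sum>j\<le>degree f. coeff f j * a ^ j)"

text \<open>\<open>[:- a, 1:]\<close> is \<open>z - a\<close>.\<close>

definition quot_left :: "quat \<Rightarrow> quat poly \<Rightarrow> quat poly" where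
  "quot_left a f = (THE g. f = [:eval_left f a:] + [:- a, 1:] \<otimes>\<^sub>q g)"

definition quot_right :: "quat \<Rightarrow> quat poly \<Rightarrow> quat poly" where
  "quot_right a f = (THE g. f = [:eval_right f a:] + g \<otimes>\<^sub>q [:- a, 1:])"

text \<open>
  Divided differences along a nonempty list \<open>[a\<^sub>1, \<dots>, a\<^sub>j]\<close>; \<open>fold\<close> applies the quotient
  operator of \<open>a\<^sub>1\<close> first and that of \<open>a\<^sub>j\<^sub>-\<^sub>1\<close> last.
\<close>

definition ddiff_left :: "quat list \<Rightarrow> quat poly \<Rightarrow> quat" where
  "ddiff_left as f = eval_left (fold quot_left (butlast as) f) (last as)"

definition ddiff_right :: "quat list \<Rightarrow> quat poly \<Rightarrow> quat" where
  "ddiff_right as f = eval_right (fold quot_right (butlast as) f) (last as)"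

section \<open>Confluent Vandermonde matrices\<close>

text \<open>Matrix indices start at 0, so the entry for \<open>z\<^sup>j\<^sup>-\<^sup>1\<close> has index \<open>j - 1\<close>.\<close>

definition vand_left1 :: "nat \<Rightarrow> quat list \<Rightarrow> quat mat" where
  "vand_left1 m as = mat (length as) m (\<lambda>(i, j). ddiff_left (take (Suc i) as) (monom 1 j))"

definition vand_right1 :: "nat \<Rightarrow> quat list \<Rightarrow> quat mat" where
  "vand_right1 m as = mat m (length as) (\<lambda>(i, j). ddiff_right (take (Suc j) as) (monom 1 i))"

definition vand_left :: "nat \<Rightarrow> quat list list \<Rightarrow> quat mat" where
  "vand_left m cs = mat_of_rows m (concat (map (\<lambda>as. rows (vand_left1 m as)) cs))"

definition vand_right :: "nat \<Rightarrow> quat list list \<Rightarrow> quat mat" where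
  "vand_right m cs = mat_of_cols m (concat (map (\<lambda>as. cols (vand_right1 m as)) cs))"

section \<open>Rank over a division ring\<close>

text \<open>
  The linear algebra libraries assume commutative scalars, so the left span, left independence
  and the dimension of the left row space are defined directly, the dimension in the manner of
  \<open>Vector_Spaces.dim\<close>.
\<close>

definition left_lincomb :: "nat \<Rightarrow> ('a::division_ring vec \<Rightarrow> 'a) \<Rightarrow> 'a vec set \<Rightarrow> 'a vec" where
  "left_lincomb n c A = vec n (\<lambda>j. \<Sum>v\<in>A. c v * v $ j)"

definition left_span :: "nat \<Rightarrow> 'a::division_ring vec set \<Rightarrow> 'a vec set" where
  "left_span n V = {left_lincomb n c A | c A. finite A \<and> A \<subseteq> V}"

definition left_indep :: "nat \<Rightarrow> 'a::division_ring vec set \<Rightarrow> bool" where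
  "left_indep n V \<longleftrightarrow>
    (\<forall>c A. finite A \<and> A \<subseteq> V \<and> left_lincomb n c A = 0\<^sub>v n \<longrightarrow> (\<forall>v\<in>A. c v = 0))"

definition left_span_dim :: "nat \<Rightarrow> 'a::division_ring vec set \<Rightarrow> nat" where
  "left_span_dim n V =
    card (SOME B. B \<subseteq> carrier_vec n \<and> left_indep n B \<and> left_span n B = left_span n V)"

definition rank :: "'a::division_ring mat \<Rightarrow> nat" where
  "rank M = left_span_dim (dim_col M) (set (rows M))"

section \<open>The integers \<open>\<mu>(S)\<close> and \<open>\<kappa>\<close>\<close>

text \<open>
  The chains are the entries of the list \<open>cs\<close>.  Everything is expressed through their positions
  because the same chain may occur repeatedly in the list.
\<close>

definition chains_in :: "quat list list \<Rightarrow> quat set \<Rightarrow> nat set" where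
  "chains_in cs S = {i. i < length cs \<and> set (cs ! i) \<subseteq> S}"

definition common_prefix :: "quat list \<Rightarrow> quat list \<Rightarrow> nat" where
  "common_prefix as bs =
    (if bs ! 0 \<noteq> as ! 0 then 0
     else Max {r. r \<le> length as \<and> r \<le> length bs \<and> (\<forall>x<r. bs ! x = as ! x)})"

definition longest_chain :: "quat list list \<Rightarrow> quat set \<Rightarrow> nat" where
  "longest_chain cs S =
    (SOME i. i \<in> chains_in cs S \<and> (\<forall>j\<in>chains_in cs S. length (cs ! j) \<le> length (cs ! i)))"

definition chain_mu :: "quat list list \<Rightarrow> quat set \<Rightarrow> nat" where
  "chain_mu cs S =
    (let i = longest_chain cs S in
     if chains_in cs S = {i} then length (cs ! i)
     else length (cs ! i) +
       Max ((\<lambda>j. length (cs ! j) - common_prefix (cs ! i) (cs ! j)) ` (chains_in cs S - {i})))"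

definition chain_kappa :: "quat list list \<Rightarrow> nat" where
  "chain_kappa cs = (\<Sum>S\<in>{S \<in> conj_classes. chains_in cs S \<noteq> {}}. chain_mu cs S)"

end

theory Submission
  imports Defs "HOL-Computational_Algebra.Polynomial_FPS"
begin

text \<open>
  Let \<open>P\<^sub>\<alpha> = (z - \<alpha>\<^sub>1) \<dots> (z - \<alpha>\<^sub>k)\<close>.  The left divided differences of \<open>f\<close> along the chain
  \<open>\<alpha>\<close> all vanish iff \<open>f\<close> lies in the right ideal \<open>P\<^sub>\<alpha> \<bbbH>[z]\<close>, so it suffices that the intersection
  of these ideals is again generated by a product of \<open>\<kappa>\<close> linear factors: then the first
  \<open>min m \<kappa>\<close> columns of the left matrix are right independent and span the others.

  Inside one conjugacy class all \<open>(z - a)(z - qcnj a)\<close> are the same central polynomial \<open>X\<close>.  If a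
  chain \<open>\<beta>\<close> leaves the longest chain \<open>\<alpha>\<close> after \<open>\<nu>\<close> steps, cancel the common factors and
  multiply by the conjugate of what remains of \<open>P\<^sub>\<beta>\<close>: the condition \<open>P\<^sub>\<alpha> g \<in> P\<^sub>\<beta> \<bbbH>[z]\<close> turns into
  divisibility by a power of \<open>X\<close> of a spherical chain product times \<open>g\<close>, which forces \<open>g\<close> to start
  with the conjugates of the last \<open>s\<close> factors of \<open>P\<^sub>\<alpha>\<close>, where \<open>s\<close> is the length of \<open>\<beta>\<close> minus \<open>\<nu>\<close>.
  These conditions are nested in \<open>s\<close>, so only the largest \<open>s\<close> counts.

  For different classes, \<open>(z - a)(z - b') = (z - b)(z - a')\<close> with \<open>a'\<close>, \<open>b'\<close> conjugate to \<open>a\<close>, \<open>b\<close>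
  allows linear factors to be moved past each other, so that the lengths add up.  The right matrix
  is the conjugate transpose of the left one for the conjugate chains.
\<close>

section \<open>Linear algebra over a division ring\<close>

text \<open>Stated for an abstract product \<open>f\<close> so that it serves both for left and for right
  combinations.\<close>

lemma homogeneous_system_nontrivial_solution:
  fixes f :: "'a::division_ring \<Rightarrow> 'a \<Rightarrow> 'a" and A :: "'i \<Rightarrow> 'j \<Rightarrow> 'a"
  assumes assoc: "\<And>a b c. f (f a b) c = f a (f b c)"
    and addl: "\<And>a b c. f (a + b) c = f a c + f b c"
    and addr: "\<And>a b c. f a (b + c) = f a b + f a c"
    and inv: "\<And>a. a \<noteq> 0 \<Longrightarrow> f a (inverse a) = 1" and one: "\<And>a. f 1 a = a"
    and "finite I" "finite J" "card I < card J"
  shows "\<exists>x. (\<exists>j\<in>J. x j \<noteq> 0) \<and> (\<forall>i\<in>I. (\<Sum>j\<in>J. f (A i j) (x j)) = 0)"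
  using assms(6-8)
proof (induction I arbitrary: J A rule: finite_induct)
  case empty
  then obtain j where "j \<in> J" by fastforce
  then show ?case by (intro exI[of _ "\<lambda>_. 1"]) auto
next
  case (insert i0 I)
  have sumr: "f a (sum g S) = (\<Sum>j\<in>S. f a (g j))" for a g and S :: "'j set"
  proof -
    have "f a 0 = 0" using addr[of a 0 0] by simp
    then show ?thesis by (induction S rule: infinite_finite_induct) (simp_all add: addr)
  qed
  have negl: "f (- a) b = - f a b" for a b
  proof -
    have "f 0 b = 0" using addl[of 0 0 b] by simp
    then have "f a b + f (- a) b = 0" using addl[of a "- a" b] by simp
    then show ?thesis by (simp add: add_eq_0_iff)
  qed
  have negr: "f a (- b) = - f a b" for a b
  proof -
    have "f a 0 = 0" using addr[of a 0 0] by simp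
    then have "f a b + f a (- b) = 0" using addr[of a b "- b"] by simp
    then show ?thesis by (simp add: add_eq_0_iff)
  qed
  show ?case
  proof (cases "\<exists>j0\<in>J. A i0 j0 \<noteq> 0")
    case False
    from insert.prems insert.hyps have "card I < card J" by simp
    from insert.IH[OF insert.prems(1) this, of A] obtain x where
      x: "\<exists>j\<in>J. x j \<noteq> 0" "\<forall>i\<in>I. (\<Sum>j\<in>J. f (A i j) (x j)) = 0" by blast
    have "f 0 b = 0" for b using addl[of 0 0 b] by simp
    then have "(\<Sum>j\<in>J. f (A i0 j) (x j)) = 0" using False by (intro sum.neutral) auto
    then show ?thesis using x by blast
  next
    case True
    then obtain j0 where j0: "j0 \<in> J" "A i0 j0 \<noteq> 0" by blast
    \<comment> \<open>Gaussian elimination: \<open>A i0 j0\<close> is the pivot, and subtracting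
      multiples of equation \<open>i0\<close> removes the unknown \<open>j0\<close> from the other
      equations.\<close>
    let ?p = "inverse (A i0 j0)" and ?J = "J - {j0}"
    have "card I < card ?J" using insert.prems insert.hyps j0 by simp
    moreover have "finite ?J" using insert.prems by simp
    ultimately obtain x where x: "\<exists>j\<in>?J. x j \<noteq> 0"
      "\<forall>i\<in>I. (\<Sum>j\<in>?J. f (A i j - f (A i j0) (f ?p (A i0 j))) (x j)) = 0"
      using insert.IH[of ?J "\<lambda>i j. A i j - f (A i j0) (f ?p (A i0 j))"] by blast
    let ?s = "\<Sum>j\<in>?J. f (A i0 j) (x j)"
    \<comment> \<open>Back substitution: this value of the unknown \<open>j0\<close> makes equation
      \<open>i0\<close> hold.\<close>
    let ?y = "x(j0 := - f ?p ?s)"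
    have split: "(\<Sum>j\<in>J. f (A i j) (?y j)) =
        - f (A i j0) (f ?p ?s) + (\<Sum>j\<in>?J. f (A i j) (x j))" for i
    proof -
      have "(\<Sum>j\<in>J. f (A i j) (?y j)) = f (A i j0) (?y j0) + (\<Sum>j\<in>?J. f (A i j) (?y j))"
        using insert.prems(1) j0(1) by (rule sum.remove)
      also have "(\<Sum>j\<in>?J. f (A i j) (?y j)) = (\<Sum>j\<in>?J. f (A i j) (x j))"
        by (intro sum.cong) auto
      finally show ?thesis by (simp add: negr)
    qed
    have "(\<Sum>j\<in>J. f (A i j) (?y j)) = 0" if "i \<in> insert i0 I" for i
    proof (cases "i = i0")
      case True
      have "f (A i0 j0) (f ?p ?s) = ?s"
        using assoc[of "A i0 j0" ?p ?s] j0(2) by (simp add: inv one)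
      then show ?thesis using split[of i0] True by simp
    next
      case False
      then have "i \<in> I" using that by simp
      then have "0 = (\<Sum>j\<in>?J. f (A i j - f (A i j0) (f ?p (A i0 j))) (x j))" using x(2) by simp
      also have "\<dots> = (\<Sum>j\<in>?J. f (A i j) (x j) - f (A i j0) (f ?p (f (A i0 j) (x j))))"
        unfolding diff_conv_add_uminus addl negl assoc ..
      also have "\<dots> = (\<Sum>j\<in>?J. f (A i j) (x j)) - f (A i j0) (f ?p ?s)"
        by (simp add: sum_subtractf sumr)
      finally show ?thesis using split[of i] by simp
    qed
    moreover have "\<exists>j\<in>J. ?y j \<noteq> 0" using x(1) by auto
    ultimately show ?thesis by blast
  qed
qed

lemma right_system_nontrivial_solution:
  fixes A :: "'i \<Rightarrow> 'j \<Rightarrow> 'a::division_ring"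
  assumes "finite I" "finite J" "card I < card J"
  obtains x j where "j \<in> J" "x j \<noteq> 0" "\<And>i. i \<in> I \<Longrightarrow> (\<Sum>j\<in>J. A i j * x j) = 0"
  using homogeneous_system_nontrivial_solution[of "(*)" I J A] assms
  by (auto simp: algebra_simps)

lemma left_system_nontrivial_solution:
  fixes A :: "'i \<Rightarrow> 'j \<Rightarrow> 'a::division_ring"
  assumes "finite I" "finite J" "card I < card J"
  obtains x j where "j \<in> J" "x j \<noteq> 0" "\<And>i. i \<in> I \<Longrightarrow> (\<Sum>j\<in>J. x j * A i j) = 0"
  using homogeneous_system_nontrivial_solution[of "\<lambda>a b. b * a" I J A] assms
  by (auto simp: algebra_simps)

section \<open>Left spans and left bases\<close>

lemma in_left_span_finite:
  assumes "finite B" "w \<in> left_span n B"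
  obtains c where "w = left_lincomb n c B"
proof -
  from assms(2) obtain c A where A: "finite A" "A \<subseteq> B" "w = left_lincomb n c A"
    by (auto simp: left_span_def)
  have "left_lincomb n c A = left_lincomb n (\<lambda>v. if v \<in> A then c v else 0) B"
    unfolding left_lincomb_def
    using A(2) assms(1) by (intro eq_vecI) (auto intro!: sum.mono_neutral_cong_left)
  then show ?thesis using that A(3) by blast
qed

lemma left_span_base: "v \<in> V \<Longrightarrow> v \<in> carrier_vec n \<Longrightarrow> v \<in> left_span n V"
  unfolding left_span_def left_lincomb_def
  by (rule CollectI, rule exI[of _ "\<lambda>_. 1"], rule exI[of _ "{v}"]) auto

lemma left_indep_subset: "left_indep n B \<Longrightarrow> A \<subseteq> B \<Longrightarrow> left_indep n A"
  unfolding left_indep_def by blast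

text \<open>Among the subsets of \<open>V\<close> with the same span, one of least cardinality is
  independent: a nontrivial relation would allow one more vector to be dropped.\<close>

lemma ex_left_basis:
  assumes "finite V" "V \<subseteq> carrier_vec n"
  shows "\<exists>B\<subseteq>V. left_indep n B \<and> left_span n B = left_span n V"
proof -
  let ?Q = "\<lambda>B. B \<subseteq> V \<and> left_span n B = left_span n V"
  have "?Q V" by simp
  then obtain B where B: "?Q B" and min: "\<And>B'. ?Q B' \<Longrightarrow> card B \<le> card B'"
    using exists_least_iff[of "\<lambda>k. \<exists>B. ?Q B \<and> card B = k"] by (metis linorder_not_less)
  have fin: "finite B" using B assms(1) finite_subset by blast
  have "left_indep n B"
  proof (rule ccontr)
    assume "\<not> left_indep n B"
    then obtain c A v where A: "finite A" "A \<subseteq> B" "left_lincomb n c A = 0\<^sub>v n"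
      and v: "v \<in> A" "c v \<noteq> 0"
      unfolding left_indep_def by blast
    have "left_span n B \<subseteq> left_span n (B - {v})"
    proof
      fix w assume "w \<in> left_span n B"
      then obtain d where d: "w = left_lincomb n d B" using in_left_span_finite[OF fin] by blast
      \<comment> \<open>Subtracting \<open>d v * inverse (c v)\<close> times the relation leaves the
        combination unchanged and makes the coefficient of \<open>v\<close> vanish.\<close>
      let ?e = "\<lambda>u. d u - (if u \<in> A then d v * inverse (c v) * c u else 0)"
      have "left_lincomb n ?e (B - {v}) = w"
        unfolding d
      proof (rule eq_vecI)
        fix j assume "j < dim_vec (left_lincomb n d B)"
        then have j: "j < n" by (simp add: left_lincomb_def)
        have "(\<Sum>u\<in>A. c u * u $ j) = 0"
          using arg_cong[OF A(3), of "\<lambda>w. w $ j"] j by (simp add: left_lincomb_def)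
        then have 0: "(\<Sum>u\<in>A. d v * inverse (c v) * c u * u $ j) = 0"
          by (simp add: mult.assoc flip: sum_distrib_left)
        have "(\<Sum>u\<in>B. ?e u * u $ j) =
            (\<Sum>u\<in>B. d u * u $ j) - (\<Sum>u\<in>B. if u \<in> A then d v * inverse (c v) * c u * u $ j else 0)"
          by (subst sum_subtractf[symmetric], intro sum.cong) (auto simp: algebra_simps)
        also have "(\<Sum>u\<in>B. if u \<in> A then d v * inverse (c v) * c u * u $ j else 0) = 0"
          using 0 A(2) fin by (simp add: sum.inter_restrict[symmetric] Int_absorb1)
        finally have "(\<Sum>u\<in>B. ?e u * u $ j) = (\<Sum>u\<in>B. d u * u $ j)" by simp
        moreover have "?e v = 0" using v by (simp add: mult.assoc)
        ultimately have "(\<Sum>u\<in>B - {v}. ?e u * u $ j) = (\<Sum>u\<in>B. d u * u $ j)"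
          using sum.remove[of B v "\<lambda>u. ?e u * u $ j"] fin v(1) A(2) by auto
        then show "left_lincomb n ?e (B - {v}) $ j = left_lincomb n d B $ j"
          using j by (simp add: left_lincomb_def)
      qed (simp add: left_lincomb_def)
      then show "w \<in> left_span n (B - {v})" using fin unfolding left_span_def by blast
    qed
    moreover have "left_span n (B - {v}) \<subseteq> left_span n B" unfolding left_span_def by blast
    ultimately have "?Q (B - {v})" using B by blast
    then have "card B \<le> card (B - {v})" by (rule min)
    moreover have "v \<in> B" using v A by blast
    ultimately show False using fin by (metis card_Diff1_less linorder_not_less)
  qed
  then show ?thesis using B by blast
qed

text \<open>\<open>left_span_dim\<close> counts a basis picked by choice, so every basis must be
  shown to have \<open>k\<close> elements. Independence gives the upper bound, generation the lower
  one.\<close>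

lemma left_span_dim_eqI:
  assumes "finite V" "V \<subseteq> carrier_vec n"
    and le: "\<And>F. finite F \<Longrightarrow> F \<subseteq> left_span n V \<Longrightarrow> left_indep n F \<Longrightarrow> card F \<le> k"
    and ge: "\<And>B. finite B \<Longrightarrow> left_span n B = left_span n V \<Longrightarrow> k \<le> card B"
  shows "left_span_dim n V = k"
proof -
  let ?Q = "\<lambda>B. B \<subseteq> carrier_vec n \<and> left_indep n B \<and> left_span n B = left_span n V"
  have "card B = k" if B: "?Q B" for B
  proof -
    have sub: "B \<subseteq> left_span n V" using B left_span_base by blast
    have card: "card F \<le> k" if "finite F" "F \<subseteq> B" for F
      using le[OF that(1)] sub that(2) B left_indep_subset by blast
    \<comment> \<open>An infinite set has \<open>card\<close> 0, so finiteness must be derived; it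
      follows from the uniform bound on finite subsets.\<close>
    have fin: "finite B"
      using card finite_if_finite_subsets_card_bdd[of B k] by blast
    show ?thesis using card[OF fin] ge[OF fin] B by fastforce
  qed
  moreover have "\<exists>B. ?Q B" using ex_left_basis[OF assms(1,2)] assms(2) by blast
  ultimately show ?thesis unfolding left_span_dim_def by (metis (mono_tags, lifting) someI_ex)
qed

section \<open>The dimension of a row space from \<open>k\<close> columns or \<open>k\<close>
  rows\<close>

lemma left_span_nthE:
  assumes "w \<in> left_span n V"
  obtains c A where "finite A" "A \<subseteq> V" "dim_vec w = n"
    "\<And>j. j < n \<Longrightarrow> w $ j = (\<Sum>v\<in>A. c v * v $ j)"
  using assms unfolding left_span_def left_lincomb_def by fastforce

text \<open>Vectors of the row span are determined by their first \<open>k\<close> coordinates, so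
  more than \<open>k\<close> of them are dependent; fewer than \<open>k\<close> generators would
  leave a nonzero \<open>x\<close> annihilating all rows.\<close>

lemma left_span_dim_eq_columns:
  fixes V :: "'a::division_ring vec set"
  assumes V: "finite V" "V \<subseteq> carrier_vec n" and "k \<le> n"
    and indep: "\<And>x. \<forall>v\<in>V. (\<Sum>i<k. v $ i * x i) = 0 \<Longrightarrow> \<forall>i<k. x i = 0"
    and span: "\<And>j. j < n \<Longrightarrow> \<exists>x. \<forall>v\<in>V. v $ j = (\<Sum>i<k. v $ i * x i)"
  shows "left_span_dim n V = k"
proof (rule left_span_dim_eqI[OF V])
  fix F assume F: "finite F" "F \<subseteq> left_span n V" "left_indep n F"
  show "card F \<le> k"
  proof (rule ccontr)
    assume "\<not> card F \<le> k"
    then obtain c v where v: "v \<in> F" "c v \<noteq> 0"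
      and c: "\<And>i. i \<in> {..<k} \<Longrightarrow> (\<Sum>v\<in>F. c v * v $ i) = 0"
      using left_system_nontrivial_solution[of "{..<k}" F "\<lambda>i v. v $ i"] F(1) by (metis card_lessThan finite_lessThan linorder_not_less)
    have "(\<Sum>v\<in>F. c v * v $ j) = 0" if j: "j < n" for j
    proof -
      from span[OF j] obtain x where x: "\<And>v. v \<in> V \<Longrightarrow> v $ j = (\<Sum>i<k. v $ i * x i)" by blast
      \<comment> \<open>Column relations carry their scalars on the right, so they pass from the
        rows to all left combinations of rows.\<close>
      have "w $ j = (\<Sum>i<k. w $ i * x i)" if w: "w \<in> left_span n V" for w
      proof -
        obtain d A where dA: "finite A" "A \<subseteq> V"
          and d: "\<And>j. j < n \<Longrightarrow> w $ j = (\<Sum>v\<in>A. d v * v $ j)"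
          using left_span_nthE[OF w] by metis
        have "w $ j = (\<Sum>v\<in>A. \<Sum>i<k. d v * v $ i * x i)"
          using d[OF j] dA x by (auto simp: sum_distrib_left mult.assoc intro!: sum.cong)
        also have "\<dots> = (\<Sum>i<k. w $ i * x i)"
          using d \<open>k \<le> n\<close> by (subst sum.swap) (auto simp: sum_distrib_right intro!: sum.cong)
        finally show ?thesis .
      qed
      then have "(\<Sum>v\<in>F. c v * v $ j) = (\<Sum>v\<in>F. \<Sum>i<k. c v * v $ i * x i)"
        using F(2) by (auto simp: sum_distrib_left mult.assoc intro!: sum.cong)
      also have "\<dots> = (\<Sum>i<k. (\<Sum>v\<in>F. c v * v $ i) * x i)"
        by (subst sum.swap) (auto simp: sum_distrib_right)
      finally show ?thesis using c by simp
    qed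
    then have "left_lincomb n c F = 0\<^sub>v n" unfolding left_lincomb_def by auto
    then show False using F v unfolding left_indep_def by blast
  qed
next
  fix B assume B: "finite B" "left_span n B = left_span n V"
  show "k \<le> card B"
  proof (rule ccontr)
    assume "\<not> k \<le> card B"
    then obtain x i where i: "i \<in> {..<k}" "x i \<noteq> 0"
      and x: "\<And>v. v \<in> B \<Longrightarrow> (\<Sum>i<k. v $ i * x i) = 0"
      using right_system_nontrivial_solution[of B "{..<k}" "\<lambda>v i. v $ i"] B(1) by (metis card_lessThan finite_lessThan linorder_not_less)
    have "(\<Sum>i<k. v $ i * x i) = 0" if "v \<in> V" for v
    proof -
      have "v \<in> left_span n B" using B(2) V(2) that left_span_base by blast
      then obtain d A where dA: "A \<subseteq> B"
        and d: "\<And>j. j < n \<Longrightarrow> v $ j = (\<Sum>b\<in>A. d b * b $ j)"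
        using left_span_nthE by metis
      have "(\<Sum>i<k. v $ i * x i) = (\<Sum>i<k. \<Sum>b\<in>A. d b * (b $ i * x i))"
        using d \<open>k \<le> n\<close> by (auto simp: sum_distrib_right mult.assoc intro!: sum.cong)
      also have "\<dots> = (\<Sum>b\<in>A. d b * (\<Sum>i<k. b $ i * x i))"
        by (subst sum.swap) (auto simp: sum_distrib_left)
      also have "\<dots> = 0" using x dA by (intro sum.neutral) auto
      finally show ?thesis .
    qed
    then show False using indep i by blast
  qed
qed

text \<open>The row counterpart, used for the right matrix. More than \<open>k\<close> vectors of
  the span have dependent coefficient families with respect to \<open>r\<close>; fewer than
  \<open>k\<close> generators would make the \<open>r i\<close> dependent.\<close>

lemma left_span_dim_eq_rows:
  fixes r :: "nat \<Rightarrow> 'a::division_ring vec"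
  assumes V: "finite V" "V \<subseteq> carrier_vec n" and r: "\<And>i. i < k \<Longrightarrow> r i \<in> V"
    and indep: "\<And>x. \<forall>j<n. (\<Sum>i<k. x i * r i $ j) = 0 \<Longrightarrow> \<forall>i<k. x i = 0"
    and span: "\<And>v. v \<in> V \<Longrightarrow> \<exists>x. \<forall>j<n. v $ j = (\<Sum>i<k. x i * r i $ j)"
  shows "left_span_dim n V = k"
proof (rule left_span_dim_eqI[OF V])
  fix F assume F: "finite F" "F \<subseteq> left_span n V" "left_indep n F"
  have "\<exists>x. \<forall>j<n. w $ j = (\<Sum>i<k. x i * r i $ j)" if w: "w \<in> F" for w
  proof -
    obtain d A where dA: "finite A" "A \<subseteq> V"
      and d: "\<And>j. j < n \<Longrightarrow> w $ j = (\<Sum>v\<in>A. d v * v $ j)"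
      using left_span_nthE w F(2) by (metis subsetD)
    obtain X where X: "\<And>v j. v \<in> V \<Longrightarrow> j < n \<Longrightarrow> v $ j = (\<Sum>i<k. X v i * r i $ j)"
      using span by metis
    have "w $ j = (\<Sum>i<k. (\<Sum>v\<in>A. d v * X v i) * r i $ j)" if j: "j < n" for j
    proof -
      have "w $ j = (\<Sum>v\<in>A. \<Sum>i<k. d v * X v i * r i $ j)"
        using d[OF j] dA X j by (auto simp: sum_distrib_left mult.assoc intro!: sum.cong)
      then show ?thesis by (subst (asm) sum.swap) (simp add: sum_distrib_right)
    qed
    then show ?thesis by (intro exI[of _ "\<lambda>i. \<Sum>v\<in>A. d v * X v i"]) auto
  qed
  then obtain X where X: "\<And>w j. w \<in> F \<Longrightarrow> j < n \<Longrightarrow> w $ j = (\<Sum>i<k. X w i * r i $ j)"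
    by metis
  show "card F \<le> k"
  proof (rule ccontr)
    assume "\<not> card F \<le> k"
    then obtain c v where v: "v \<in> F" "c v \<noteq> 0"
      and c: "\<And>i. i \<in> {..<k} \<Longrightarrow> (\<Sum>v\<in>F. c v * X v i) = 0"
      using left_system_nontrivial_solution[of "{..<k}" F "\<lambda>i v. X v i"] F(1) by (metis card_lessThan finite_lessThan linorder_not_less)
    have "(\<Sum>v\<in>F. c v * v $ j) = 0" if j: "j < n" for j
    proof -
      have "(\<Sum>v\<in>F. c v * v $ j) = (\<Sum>v\<in>F. \<Sum>i<k. c v * X v i * r i $ j)"
        using X j by (auto simp: sum_distrib_left mult.assoc intro!: sum.cong)
      also have "\<dots> = (\<Sum>i<k. (\<Sum>v\<in>F. c v * X v i) * r i $ j)"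
        by (subst sum.swap) (auto simp: sum_distrib_right)
      finally show ?thesis using c by simp
    qed
    then have "left_lincomb n c F = 0\<^sub>v n" unfolding left_lincomb_def by auto
    then show False using F v unfolding left_indep_def by blast
  qed
next
  fix B assume B: "finite B" "left_span n B = left_span n V"
  have "\<exists>c. r i = left_lincomb n c B" if "i < k" for i
    using in_left_span_finite[OF B(1), of "r i" n] left_span_base[OF r[OF that], of n]
      r[OF that] V(2) B(2) by (metis subsetD)
  then obtain C where C: "\<And>i. i < k \<Longrightarrow> r i = left_lincomb n (C i) B" by metis
  show "k \<le> card B"
  proof (rule ccontr)
    assume "\<not> k \<le> card B"
    then obtain x i where i: "i \<in> {..<k}" "x i \<noteq> 0"
      and x: "\<And>b. b \<in> B \<Longrightarrow> (\<Sum>i<k. x i * C i b) = 0"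
      using left_system_nontrivial_solution[of B "{..<k}" "\<lambda>b i. C i b"] B(1) by (metis card_lessThan finite_lessThan linorder_not_less)
    have "(\<Sum>i<k. x i * r i $ j) = 0" if j: "j < n" for j
    proof -
      have "(\<Sum>i<k. x i * r i $ j) = (\<Sum>i<k. \<Sum>b\<in>B. x i * C i b * b $ j)"
        using C j by (auto simp: left_lincomb_def sum_distrib_left mult.assoc intro!: sum.cong)
      also have "\<dots> = (\<Sum>b\<in>B. (\<Sum>i<k. x i * C i b) * b $ j)"
        by (subst sum.swap) (auto simp: sum_distrib_right)
      finally show ?thesis using x by simp
    qed
    then show False using indep i by blast
  qed
qed

section \<open>The ring of quaternion polynomials\<close>

lemma coeff_qpoly_mult: "coeff (f \<otimes>\<^sub>q g) n = (\<Sum>i\<le>n. coeff f i * coeff g (n - i))"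
proof -
  have inner: "(\<Sum>j\<le>degree g. coeff (monom (coeff f i * coeff g j) (i + j)) n) =
      (if i \<le> n then coeff f i * coeff g (n - i) else 0)" for i
  proof -
    have "(\<Sum>j\<le>degree g. coeff (monom (coeff f i * coeff g j) (i + j)) n) =
        (\<Sum>j\<le>degree g. if j = n - i \<and> i \<le> n then coeff f i * coeff g (n - i) else 0)"
      by (intro sum.cong) auto
    also have "\<dots> = (if i \<le> n then coeff f i * coeff g (n - i) else 0)"
      by (auto simp: coeff_eq_0)
    finally show ?thesis .
  qed
  have "coeff (f \<otimes>\<^sub>q g) n = (\<Sum>i\<le>degree f. if i \<le> n then coeff f i * coeff g (n - i) else 0)"
    by (simp add: qpoly_mult_def coeff_sum inner del: coeff_monom)
  also have "\<dots> = (\<Sum>i | i \<le> degree f \<and> i \<le> n. coeff f i * coeff g (n - i))"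
    by (rule sum.mono_neutral_cong_right) auto
  also have "\<dots> = (\<Sum>i\<le>n. coeff f i * coeff g (n - i))"
    by (rule sum.mono_neutral_cong_left) (auto intro: le_degree)
  finally show ?thesis .
qed

text \<open>The product of formal power series makes sense over noncommutative coefficients, so the
  ring laws and the absence of zero divisors are inherited through this injective map.\<close>

lemma fps_of_qpoly_mult: "fps_of_poly (f \<otimes>\<^sub>q g) = fps_of_poly f * fps_of_poly g"
  by (simp add: fps_eq_iff fps_mult_nth coeff_qpoly_mult atLeast0AtMost)

lemma qpoly_mult_assoc: "f \<otimes>\<^sub>q g \<otimes>\<^sub>q h = f \<otimes>\<^sub>q (g \<otimes>\<^sub>q h)"
  by (simp add: fps_of_qpoly_mult mult.assoc flip: fps_of_poly_eq_iff)

lemma qpoly_mult_distrib: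
  "(f + g) \<otimes>\<^sub>q h = f \<otimes>\<^sub>q h + g \<otimes>\<^sub>q h" "h \<otimes>\<^sub>q (f + g) = h \<otimes>\<^sub>q f + h \<otimes>\<^sub>q g"
  "(f - g) \<otimes>\<^sub>q h = f \<otimes>\<^sub>q h - g \<otimes>\<^sub>q h" "h \<otimes>\<^sub>q (f - g) = h \<otimes>\<^sub>q f - h \<otimes>\<^sub>q g"
  by (simp_all add: fps_of_qpoly_mult algebra_simps fps_of_poly_add fps_of_poly_diff
      flip: fps_of_poly_eq_iff)

lemma qpoly_mult_simps [simp]:
  "0 \<otimes>\<^sub>q f = 0" "f \<otimes>\<^sub>q 0 = 0" "[:1:] \<otimes>\<^sub>q f = f" "f \<otimes>\<^sub>q [:1:] = f"
  by (simp_all add: fps_of_qpoly_mult flip: fps_of_poly_eq_iff)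

lemma qpoly_mult_eq_0_iff [simp]: "f \<otimes>\<^sub>q g = 0 \<longleftrightarrow> f = 0 \<or> g = 0"
  by (metis fps_of_poly_0 fps_of_poly_eq_iff fps_of_qpoly_mult mult_eq_0_iff)

lemma qpoly_mult_left_cancel: "h \<noteq> 0 \<Longrightarrow> h \<otimes>\<^sub>q f = h \<otimes>\<^sub>q g \<longleftrightarrow> f = g"
  using qpoly_mult_eq_0_iff[of h "f - g"] by (auto simp: qpoly_mult_distrib)

lemma qpoly_mult_pCons_right: "f \<otimes>\<^sub>q pCons b g = f \<otimes>\<^sub>q [:b:] + pCons 0 (f \<otimes>\<^sub>q g)"
proof (rule poly_eqI)
  fix n show "coeff (f \<otimes>\<^sub>q pCons b g) n = coeff (f \<otimes>\<^sub>q [:b:] + pCons 0 (f \<otimes>\<^sub>q g)) n"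
    by (cases n) (auto simp: coeff_qpoly_mult coeff_pCons Suc_diff_le intro!: sum.cong)
qed

lemma qpoly_mult_pCons_left: "pCons a f \<otimes>\<^sub>q g = [:a:] \<otimes>\<^sub>q g + pCons 0 (f \<otimes>\<^sub>q g)"
proof (rule poly_eqI)
  fix n show "coeff (pCons a f \<otimes>\<^sub>q g) n = coeff ([:a:] \<otimes>\<^sub>q g + pCons 0 (f \<otimes>\<^sub>q g)) n"
    by (cases n) (auto simp: coeff_qpoly_mult sum.atMost_Suc_shift coeff_pCons
        simp del: sum.atMost_Suc intro!: sum.neutral split: nat.splits)
qed

lemma coeff_const_qpoly_mult: "coeff ([:a:] \<otimes>\<^sub>q f) n = a * coeff f n"
proof -
  have "(\<Sum>i\<in>{..n} - {0}. coeff [:a:] i * coeff f (n - i)) = 0"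
    by (intro sum.neutral) (auto simp: coeff_pCons split: nat.splits)
  then show ?thesis by (simp add: coeff_qpoly_mult sum.remove[of "{..n}" 0])
qed

lemma const_qpoly_mult_pCons: "[:a:] \<otimes>\<^sub>q pCons b f = pCons (a * b) ([:a:] \<otimes>\<^sub>q f)"
  by (rule poly_eqI) (simp add: coeff_const_qpoly_mult coeff_pCons split: nat.split)

lemma pCons_qpoly_mult_const: "pCons a f \<otimes>\<^sub>q [:b:] = pCons (a * b) (f \<otimes>\<^sub>q [:b:])"
  by (subst qpoly_mult_pCons_left) (simp add: const_qpoly_mult_pCons)

lemma degree_qpoly_mult:
  assumes "f \<noteq> 0" "g \<noteq> 0"
  shows "degree (f \<otimes>\<^sub>q g) = degree f + degree g"
proof (rule antisym)
  show "degree (f \<otimes>\<^sub>q g) \<le> degree f + degree g"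
  proof (rule degree_le, intro allI impI)
    fix n assume n: "degree f + degree g < n"
    have "coeff f i * coeff g (n - i) = 0" for i
      using n by (cases "i \<le> degree f") (auto simp: coeff_eq_0)
    then show "coeff (f \<otimes>\<^sub>q g) n = 0" unfolding coeff_qpoly_mult by (intro sum.neutral) simp
  qed
  let ?n = "degree f + degree g"
  have "coeff (f \<otimes>\<^sub>q g) ?n = (\<Sum>i\<in>{degree f}. coeff f i * coeff g (?n - i))"
    unfolding coeff_qpoly_mult
  proof (rule sum.mono_neutral_right)
    show "\<forall>i\<in>{..?n} - {degree f}. coeff f i * coeff g (?n - i) = 0"
    proof
      fix i assume "i \<in> {..?n} - {degree f}"
      then have "i > degree f \<or> ?n - i > degree g" by auto
      then show "coeff f i * coeff g (?n - i) = 0" by (auto simp: coeff_eq_0)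
    qed
  qed auto
  then show "?n \<le> degree (f \<otimes>\<^sub>q g)" using assms by (intro le_degree) simp
qed

lemma central_qpoly_mult_commute:
  assumes "\<And>i y. coeff f i * y = y * coeff f i"
  shows "f \<otimes>\<^sub>q g = g \<otimes>\<^sub>q f"
proof (rule poly_eqI)
  fix n
  have "(\<Sum>i\<le>n. coeff f i * coeff g (n - i)) = (\<Sum>i\<le>n. coeff f (n - i) * coeff g (n - (n - i)))"
    using sum.atLeastAtMost_rev[of "\<lambda>i. coeff f i * coeff g (n - i)" 0 n]
    by (simp add: atMost_atLeast0)
  also have "\<dots> = (\<Sum>i\<le>n. coeff g i * coeff f (n - i))"
    by (intro sum.cong) (auto simp: assms)
  finally show "coeff (f \<otimes>\<^sub>q g) n = coeff (g \<otimes>\<^sub>q f) n" by (simp add: coeff_qpoly_mult)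
qed

subsection \<open>Evaluation and division by a linear factor\<close>

abbreviation lin :: "quat \<Rightarrow> quat poly" where "lin a \<equiv> [:- a, 1:]"

lemma eval_left_altdef: "degree f \<le> n \<Longrightarrow> eval_left f a = (\<Sum>j\<le>n. a ^ j * coeff f j)"
  unfolding eval_left_def by (rule sum.mono_neutral_left) (auto simp: coeff_eq_0)

lemma eval_left_add: "eval_left (f + g) a = eval_left f a + eval_left g a"
proof -
  let ?n = "max (degree f) (degree g)"
  have "degree (f + g) \<le> ?n" by (rule degree_add_le_max)
  then show ?thesis
    by (simp add: eval_left_altdef[of _ ?n] sum.distrib algebra_simps)
qed

lemma eval_left_0 [simp]: "eval_left 0 a = 0"
  by (simp add: eval_left_def)

lemma eval_left_pCons [simp]: "eval_left (pCons c f) a = c + a * eval_left f a"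
proof -
  have "eval_left (pCons c f) a = (\<Sum>j\<le>Suc (degree f). a ^ j * coeff (pCons c f) j)"
    by (rule eval_left_altdef) (rule degree_pCons_le)
  also have "\<dots> = c + a * (\<Sum>j\<le>degree f. a ^ j * coeff f j)"
    by (simp add: sum.atMost_Suc_shift sum_distrib_left mult.assoc del: sum.atMost_Suc)
  finally show ?thesis by (simp add: eval_left_def)
qed

lemma eval_left_mult_const: "eval_left (f \<otimes>\<^sub>q [:c:]) a = eval_left f a * c"
  by (induction f) (simp_all add: pCons_qpoly_mult_const algebra_simps)

text \<open>Left evaluation is not multiplicative, but it is additive and compatible with right
  constants, and a factor z of the second polynomial only contributes a left factor
  \<open>a\<close>.\<close>

lemma eval_left_mult_eq_0: "eval_left f a = 0 \<Longrightarrow> eval_left (f \<otimes>\<^sub>q g) a = 0"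
proof (induction g)
  case (pCons b g)
  then show ?case
    by (subst qpoly_mult_pCons_right) (simp add: eval_left_add eval_left_mult_const)
qed simp

lemma eval_left_lin_mult [simp]: "eval_left (lin a \<otimes>\<^sub>q g) a = 0"
  by (rule eval_left_mult_eq_0) simp

lemma lin_mult: "lin a \<otimes>\<^sub>q f = pCons 0 f - [:a:] \<otimes>\<^sub>q f"
proof -
  have "lin a = [:0, 1:] - [:a:]" by simp
  moreover have "[:0, 1:] \<otimes>\<^sub>q f = pCons 0 f"
    using qpoly_mult_pCons_left[of 0 "[:1:]" f] by simp
  ultimately show ?thesis by (simp only: qpoly_mult_distrib)
qed

lemma ex_lin_division: "\<exists>r g. f = [:r:] + lin a \<otimes>\<^sub>q g"
proof (induction f)
  case 0
  have "0 = [:0:] + lin a \<otimes>\<^sub>q 0" by simp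
  then show ?case by blast
next
  case (pCons c f)
  then obtain r g where f: "f = [:r:] + lin a \<otimes>\<^sub>q g" by blast
  \<comment> \<open>Here z f = a f + (z - a) f; the constant \<open>a\<close> commutes with z - a,
    so the division of \<open>f\<close> can be multiplied by \<open>a\<close> from the left.\<close>
  have "pCons c f = [:c:] + [:a:] \<otimes>\<^sub>q f + lin a \<otimes>\<^sub>q f" by (simp add: lin_mult)
  also have "[:a:] \<otimes>\<^sub>q f = [:a * r:] + lin a \<otimes>\<^sub>q ([:a:] \<otimes>\<^sub>q g)"
  proof -
    have "[:a:] \<otimes>\<^sub>q lin a = lin a \<otimes>\<^sub>q [:a:]"
      by (simp add: const_qpoly_mult_pCons pCons_qpoly_mult_const)
    then show ?thesis
      by (simp add: f qpoly_mult_distrib const_qpoly_mult_pCons flip: qpoly_mult_assoc)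
  qed
  finally have "pCons c f = [:c + a * r:] + lin a \<otimes>\<^sub>q ([:a:] \<otimes>\<^sub>q g + f)"
    by (simp add: qpoly_mult_distrib add.assoc)
  then show ?case by blast
qed

text \<open>Resolves the \<open>THE\<close> in \<open>quot_left\<close>: evaluation at
  \<open>a\<close> fixes the remainder, and cancelling \<open>lin a\<close> fixes the
  quotient.\<close>

lemma lin_division_unique:
  assumes "f = [:r:] + lin a \<otimes>\<^sub>q g"
  shows "r = eval_left f a" "g = quot_left a f"
proof -
  show r: "r = eval_left f a" by (simp add: assms eval_left_add)
  show "g = quot_left a f"
    unfolding quot_left_def
  proof (rule the_equality[symmetric])
    fix g' assume "f = [:eval_left f a:] + lin a \<otimes>\<^sub>q g'"
    then have "lin a \<otimes>\<^sub>q g' = lin a \<otimes>\<^sub>q g" using assms r by (metis add_left_imp_eq)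
    then show "g' = g" by (simp add: qpoly_mult_left_cancel)
  qed (use assms r in simp)
qed

lemma lin_division: "f = [:eval_left f a:] + lin a \<otimes>\<^sub>q quot_left a f"
  using ex_lin_division[of f a] lin_division_unique by metis

lemma quot_left_add: "quot_left a (f + g) = quot_left a f + quot_left a g"
proof (rule lin_division_unique(2)[symmetric])
  have "f + g = ([:eval_left f a:] + lin a \<otimes>\<^sub>q quot_left a f) +
      ([:eval_left g a:] + lin a \<otimes>\<^sub>q quot_left a g)"
    by (simp only: lin_division[symmetric])
  also have "\<dots> = ([:eval_left f a:] + [:eval_left g a:]) +
      (lin a \<otimes>\<^sub>q quot_left a f + lin a \<otimes>\<^sub>q quot_left a g)"
    by (simp only: ac_simps)
  also have "\<dots> = [:eval_left f a + eval_left g a:] +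
      lin a \<otimes>\<^sub>q (quot_left a f + quot_left a g)"
    by (simp only: qpoly_mult_distrib(2) add_pCons add_0_left)
  finally show "f + g = [:eval_left f a + eval_left g a:] +
      lin a \<otimes>\<^sub>q (quot_left a f + quot_left a g)" .
qed

lemma quot_left_mult_const: "quot_left a (f \<otimes>\<^sub>q [:c:]) = quot_left a f \<otimes>\<^sub>q [:c:]"
proof (rule lin_division_unique(2)[symmetric])
  have "f \<otimes>\<^sub>q [:c:] = ([:eval_left f a:] + lin a \<otimes>\<^sub>q quot_left a f) \<otimes>\<^sub>q [:c:]"
    by (simp only: lin_division[symmetric])
  also have "\<dots> = [:eval_left f a * c:] + lin a \<otimes>\<^sub>q (quot_left a f \<otimes>\<^sub>q [:c:])"
    by (simp only: qpoly_mult_distrib(1) qpoly_mult_assoc pCons_qpoly_mult_const qpoly_mult_simps)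
  finally show "f \<otimes>\<^sub>q [:c:] = [:eval_left f a * c:] + lin a \<otimes>\<^sub>q (quot_left a f \<otimes>\<^sub>q [:c:])" .
qed

subsection \<open>Right ideals and products of linear factors\<close>

definition right_ideal :: "quat poly \<Rightarrow> quat poly set" where
  "right_ideal p = range ((\<otimes>\<^sub>q) p)"

lemma right_idealI [intro]: "p \<otimes>\<^sub>q g \<in> right_ideal p"
  by (simp add: right_ideal_def)

lemma right_idealE: "f \<in> right_ideal p \<Longrightarrow> (\<And>g. f = p \<otimes>\<^sub>q g \<Longrightarrow> thesis) \<Longrightarrow> thesis"
  by (auto simp: right_ideal_def)

lemma right_ideal_diff: "f \<in> right_ideal p \<Longrightarrow> g \<in> right_ideal p \<Longrightarrow> f - g \<in> right_ideal p"
  by (metis qpoly_mult_distrib(4) right_idealE right_idealI)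

lemma right_ideal_mult: "f \<in> right_ideal p \<Longrightarrow> f \<otimes>\<^sub>q g \<in> right_ideal p"
  by (metis qpoly_mult_assoc right_idealE right_idealI)

lemma right_ideal_mult_left_iff:
  "h \<noteq> 0 \<Longrightarrow> h \<otimes>\<^sub>q f \<in> right_ideal (h \<otimes>\<^sub>q p) \<longleftrightarrow> f \<in> right_ideal p"
  by (metis qpoly_mult_assoc qpoly_mult_left_cancel right_idealE right_idealI)

lemma degree_right_ideal: "f \<in> right_ideal p \<Longrightarrow> f \<noteq> 0 \<Longrightarrow> degree p \<le> degree f"
  by (metis degree_qpoly_mult le_add1 qpoly_mult_eq_0_iff right_idealE)

lemma right_ideal_lin_iff: "f \<in> right_ideal (lin a) \<longleftrightarrow> eval_left f a = 0"
proof
  show "eval_left f a = 0" if "f \<in> right_ideal (lin a)" using that by (auto elim: right_idealE)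
  show "f \<in> right_ideal (lin a)" if "eval_left f a = 0"
    using lin_division[of f a] that by (metis add_0 pCons_0_0 right_idealI)
qed

definition lin_prod :: "quat list \<Rightarrow> quat poly" where
  "lin_prod as = foldr (\<lambda>a p. lin a \<otimes>\<^sub>q p) as [:1:]"

lemma lin_prod_simps [simp]:
  "lin_prod [] = [:1:]" "lin_prod (a # as) = lin a \<otimes>\<^sub>q lin_prod as"
  by (simp_all add: lin_prod_def)

lemma lin_prod_append [simp]: "lin_prod (as @ bs) = lin_prod as \<otimes>\<^sub>q lin_prod bs"
  by (induction as) (simp_all add: qpoly_mult_assoc)

lemma lin_prod_nonzero [simp]: "lin_prod as \<noteq> 0"
  by (induction as) auto

lemma degree_lin_prod [simp]: "degree (lin_prod as) = length as"
  by (induction as) (auto simp: degree_qpoly_mult)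

text \<open>One linear factor is divided off at a time. The remainder is bounded through its
  coefficients rather than its degree, so that the empty product forces
  \<open>r = 0\<close>.\<close>

lemma lin_prod_division: "\<exists>q r. f = lin_prod as \<otimes>\<^sub>q q + r \<and> (\<forall>i\<ge>length as. coeff r i = 0)"
proof (induction as arbitrary: f)
  case Nil
  show ?case by (intro exI[of _ f] exI[of _ 0]) auto
next
  case (Cons a as)
  obtain q r where qr: "quot_left a f = lin_prod as \<otimes>\<^sub>q q + r" "\<forall>i\<ge>length as. coeff r i = 0"
    using Cons.IH by blast
  let ?r = "[:eval_left f a:] + lin a \<otimes>\<^sub>q r"
  have "f = lin_prod (a # as) \<otimes>\<^sub>q q + ?r"
    by (subst lin_division[of f a]) (simp add: qr(1) qpoly_mult_distrib qpoly_mult_assoc)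
  moreover have "\<forall>i\<ge>length (a # as). coeff ?r i = 0"
  proof (intro allI impI)
    fix i assume "length (a # as) \<le> i"
    then obtain j where i: "i = Suc j" "length as \<le> j" by (metis Suc_le_D Suc_le_mono length_Cons)
    then show "coeff ?r i = 0" using qr(2) by (simp add: lin_mult coeff_const_qpoly_mult)
  qed
  ultimately show ?case by blast
qed

subsection \<open>Divided differences\<close>

lemma ddiff_left_singleton: "ddiff_left [a] f = eval_left f a"
  by (simp add: ddiff_left_def)

lemma ddiff_left_Cons: "as \<noteq> [] \<Longrightarrow> ddiff_left (a # as) f = ddiff_left as (quot_left a f)"
  by (simp add: ddiff_left_def)

lemma ddiff_left_add: "ddiff_left as (f + g) = ddiff_left as f + ddiff_left as g"
proof -
  have "fold quot_left bs (f + g) = fold quot_left bs f + fold quot_left bs g" for bs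
    by (induction bs arbitrary: f g) (simp_all add: quot_left_add)
  then show ?thesis by (simp add: ddiff_left_def eval_left_add)
qed

lemma ddiff_left_mult_const: "ddiff_left as (f \<otimes>\<^sub>q [:c:]) = ddiff_left as f * c"
proof -
  have "fold quot_left bs (f \<otimes>\<^sub>q [:c:]) = fold quot_left bs f \<otimes>\<^sub>q [:c:]" for bs
    by (induction bs arbitrary: f) (simp_all add: quot_left_mult_const)
  then show ?thesis by (simp add: ddiff_left_def eval_left_mult_const)
qed

text \<open>Right linearity lets a right combination of matrix columns be read as the divided
  difference of a single polynomial.\<close>

lemma ddiff_left_sum_monom:
  "ddiff_left as (\<Sum>i<k. monom (x i) i) = (\<Sum>i<k. ddiff_left as (monom 1 i) * x i)"
proof -
  have "monom 1 i \<otimes>\<^sub>q [:c:] = monom c i" for i and c :: quat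
    by (induction i) (simp_all add: monom_0 monom_Suc pCons_qpoly_mult_const)
  then have monom: "ddiff_left as (monom c i) = ddiff_left as (monom 1 i) * c" for c i
    by (metis ddiff_left_mult_const)
  have "ddiff_left as 0 = 0"
    using ddiff_left_mult_const[of as 0 0] by simp
  then show ?thesis by (induction k) (simp_all add: ddiff_left_add monom[of "x _"])
qed

text \<open>The first condition says that \<open>lin a\<close> divides \<open>f\<close> on the left;
  the later ones are the conditions for the shorter list on the quotient.\<close>

lemma ddiff_left_eq_0_iff:
  "(\<forall>i<length as. ddiff_left (take (Suc i) as) f = 0) \<longleftrightarrow> f \<in> right_ideal (lin_prod as)"
proof (induction as arbitrary: f)
  case Nil
  show ?case using right_idealI[of "[:1:]" f] by simp
next
  case (Cons a as)
  have "(\<forall>i<length (a # as). ddiff_left (take (Suc i) (a # as)) f = 0) \<longleftrightarrow>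
      eval_left f a = 0 \<and> (\<forall>i<length as. ddiff_left (take (Suc i) as) (quot_left a f) = 0)"
  proof -
    have "ddiff_left (a # take (Suc i) as) f = ddiff_left (take (Suc i) as) (quot_left a f)"
      if "i < length as" for i
      using that by (intro ddiff_left_Cons) auto
    then show ?thesis by (simp add: All_less_Suc2 ddiff_left_singleton)
  qed
  also have "\<dots> \<longleftrightarrow> eval_left f a = 0 \<and> quot_left a f \<in> right_ideal (lin_prod as)"
    by (simp only: Cons.IH)
  also have "\<dots> \<longleftrightarrow> f \<in> right_ideal (lin_prod (a # as))"
  proof (cases "eval_left f a = 0")
    case True
    then have "f = lin a \<otimes>\<^sub>q quot_left a f" using lin_division[of f a] by simp
    then show ?thesis
      using True right_ideal_mult_left_iff[of "lin a" "quot_left a f" "lin_prod as"] by simp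
  next
    case False
    then show ?thesis by (auto elim!: right_idealE simp: qpoly_mult_assoc)
  qed
  finally show ?case .
qed

section \<open>Conjugacy classes\<close>

lemma qcnj_qcnj [simp]: "qcnj (qcnj a) = a"
  by (simp add: quat_eq_iff)

lemma qcnj_eq_iff [simp]: "qcnj a = qcnj b \<longleftrightarrow> a = b"
  by (metis qcnj_qcnj)

lemma qcnj_add: "qcnj (a + b) = qcnj a + qcnj b"
  by (simp add: quat_eq_iff)

lemma qcnj_mult: "qcnj (a * b) = qcnj b * qcnj a"
  by (simp add: quat_eq_iff algebra_simps)

text \<open>The real quadratic z^2 - 2 Re(a) z + |a|^2. It is central and takes equal values exactly
  on conjugate quaternions, so it serves as a label for conjugacy classes.\<close>

definition char_poly :: "quat \<Rightarrow> quat poly" where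
  "char_poly a = lin a \<otimes>\<^sub>q lin (qcnj a)"

lemma char_poly_eq: "char_poly a = [:a * qcnj a, - (a + qcnj a), 1:]"
  unfolding char_poly_def by (subst lin_mult) (simp add: const_qpoly_mult_pCons)

lemma char_poly_nonzero [simp]: "char_poly a \<noteq> 0"
  by (simp add: char_poly_eq)

lemma qcnj_mult_self: "qcnj a * a = a * qcnj a"
  by (simp add: quat_eq_iff)

lemma char_poly_qcnj [simp]: "char_poly (qcnj a) = char_poly a"
  by (simp add: char_poly_eq add.commute qcnj_mult_self)

lemma char_poly_central: "char_poly a \<otimes>\<^sub>q f = f \<otimes>\<^sub>q char_poly a"
proof (rule central_qpoly_mult_commute)
  fix i y
  show "coeff (char_poly a) i * y = y * coeff (char_poly a) i"
    by (auto simp: char_poly_eq coeff_pCons quat_eq_iff algebra_simps split: nat.splits)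
qed

lemma char_poly_left_commute:
  "f \<otimes>\<^sub>q (char_poly a \<otimes>\<^sub>q g) = char_poly a \<otimes>\<^sub>q (f \<otimes>\<^sub>q g)"
  by (metis char_poly_central qpoly_mult_assoc)

section \<open>Real part and norm as complete conjugacy invariants\<close>

definition qnorm :: "quat \<Rightarrow> real" where
  "qnorm a = (qRe a)\<^sup>2 + (qI a)\<^sup>2 + (qJ a)\<^sup>2 + (qK a)\<^sup>2"

lemma qnorm_mult: "qnorm (a * b) = qnorm a * qnorm b"
  by (simp add: qnorm_def power2_eq_square algebra_simps)

lemma qnorm_eq_0_iff: "qnorm a = 0 \<longleftrightarrow> a = 0"
  unfolding qnorm_def quat_eq_iff by (auto simp: add_nonneg_eq_0_iff)

lemma char_poly_eq_iff: "char_poly a = char_poly b \<longleftrightarrow> qRe a = qRe b \<and> qnorm a = qnorm b"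
  by (auto simp: char_poly_eq quat_eq_iff qnorm_def power2_eq_square)

lemma qsim_iff_intertwine: "qsim a b \<longleftrightarrow> (\<exists>h. h \<noteq> 0 \<and> h * a = b * h)"
proof -
  have "a = inverse h * b * h \<longleftrightarrow> h * a = b * h" if "h \<noteq> 0" for h :: quat
  proof
    assume "a = inverse h * b * h"
    then have "h * a = (h * inverse h) * b * h" by (simp only: mult.assoc)
    then show "h * a = b * h" using that by simp
  next
    assume "h * a = b * h"
    then have "inverse h * b * h = (inverse h * h) * a" by (simp only: mult.assoc)
    then show "a = inverse h * b * h" using that by simp
  qed
  then show ?thesis unfolding qsim_def by blast
qed

lemma qsim_iff_char_poly: "qsim a b \<longleftrightarrow> char_poly a = char_poly b"
proof
  assume "qsim a b"
  then obtain h where h: "h \<noteq> 0" "a = inverse h * b * h" unfolding qsim_def by blast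
  \<comment> \<open>The real part behaves like a trace and the norm is multiplicative; hence both
    are invariant under conjugation.\<close>
  have Re: "qRe (x * y) = qRe (y * x)" for x y :: quat by (simp add: algebra_simps)
  have "qRe a = qRe (h * (inverse h * b))" unfolding h(2) by (rule Re)
  also have "h * (inverse h * b) = b" using h(1) by (simp flip: mult.assoc)
  finally have "qRe a = qRe b" .
  moreover have "qnorm a = qnorm b"
  proof -
    have "h * a = b * h" using h by (simp flip: mult.assoc)
    then have "qnorm h * qnorm a = qnorm h * qnorm b"
      by (metis qnorm_mult mult.commute)
    then show ?thesis using h(1) qnorm_eq_0_iff by simp
  qed
  ultimately show "char_poly a = char_poly b" by (simp add: char_poly_eq_iff)
next
  assume "char_poly a = char_poly b"
  then have Re: "qRe a = qRe b" and N: "qnorm a = qnorm b" by (simp_all add: char_poly_eq_iff)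
  have N': "(qI a)\<^sup>2 + (qJ a)\<^sup>2 + (qK a)\<^sup>2 = (qI b)\<^sup>2 + (qJ b)\<^sup>2 + (qK b)\<^sup>2"
    using Re N by (simp add: qnorm_def)
  text \<open>The sum of the imaginary parts intertwines \<open>a\<close> and \<open>b\<close>; if it vanishes, any imaginary
    quaternion orthogonal to them does.\<close>
  define h where "h = (if qI a + qI b = 0 \<and> qJ a + qJ b = 0 \<and> qK a + qK b = 0
    then if qI a = 0 \<and> qJ a = 0 then Quat 0 1 0 0 else Quat 0 (- qJ a) (qI a) 0
    else Quat 0 (qI a + qI b) (qJ a + qJ b) (qK a + qK b))"
  have "h \<noteq> 0" by (auto simp: h_def quat_eq_iff)
  moreover have "h * a = b * h"
  proof (cases "qI a + qI b = 0 \<and> qJ a + qJ b = 0 \<and> qK a + qK b = 0")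
    case True
    then have "qI b = - qI a" "qJ b = - qJ a" "qK b = - qK a" by simp_all
    then show ?thesis using Re by (simp add: h_def quat_eq_iff algebra_simps)
  next
    case False
    then have "h = Quat 0 (qI a + qI b) (qJ a + qJ b) (qK a + qK b)"
      by (simp only: h_def if_False)
    then show ?thesis using Re N'
      by (simp add: quat_eq_iff algebra_simps power2_eq_square)
  qed
  ultimately show "qsim a b" unfolding qsim_iff_intertwine by blast
qed

section \<open>Chains in one conjugacy class\<close>

primrec qpoly_power :: "quat poly \<Rightarrow> nat \<Rightarrow> quat poly" where
  "qpoly_power x 0 = [:1:]"
| "qpoly_power x (Suc n) = x \<otimes>\<^sub>q qpoly_power x n"

lemma char_poly_power_central:
  "qpoly_power (char_poly a) n \<otimes>\<^sub>q f = f \<otimes>\<^sub>q qpoly_power (char_poly a) n"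
proof (induction n)
  case (Suc n)
  have "char_poly a \<otimes>\<^sub>q (qpoly_power (char_poly a) n \<otimes>\<^sub>q f) =
      (char_poly a \<otimes>\<^sub>q f) \<otimes>\<^sub>q qpoly_power (char_poly a) n"
    by (simp only: Suc qpoly_mult_assoc)
  then show ?case by (simp add: qpoly_mult_assoc char_poly_central[of a f])
qed simp

text \<open>The product collapses from the inside out: the inner part is a power of the central
  quadratic, so it can be moved past \<open>lin (qcnj a)\<close>, and the outer pair closes
  up.\<close>

lemma lin_prod_mult_conj:
  assumes "\<forall>a\<in>set as. char_poly a = char_poly e"
  shows "lin_prod as \<otimes>\<^sub>q lin_prod (map qcnj (rev as)) = qpoly_power (char_poly e) (length as)"
  using assms
proof (induction as)
  case (Cons a as)
  have "lin_prod (a # as) \<otimes>\<^sub>q lin_prod (map qcnj (rev (a # as))) =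
      lin a \<otimes>\<^sub>q (lin_prod as \<otimes>\<^sub>q lin_prod (map qcnj (rev as))) \<otimes>\<^sub>q lin (qcnj a)"
    by (simp add: qpoly_mult_assoc)
  also have "\<dots> = lin a \<otimes>\<^sub>q lin (qcnj a) \<otimes>\<^sub>q qpoly_power (char_poly e) (length as)"
    using Cons by (simp add: qpoly_mult_assoc char_poly_power_central)
  also have "\<dots> = qpoly_power (char_poly e) (length (a # as))"
    using Cons.prems by (simp flip: char_poly_def)
  finally show ?case .
qed simp

text \<open>The central quadratic does not divide the product of a spherical chain. Hence the
  constant remainder of \<open>g\<close> modulo \<open>lin (qcnj y)\<close> must vanish; otherwise
  it could be inverted.\<close>

lemma chain_mult_in_char_ideal:
  assumes "\<forall>a\<in>set (c @ [y]). char_poly a = char_poly e"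
    and "successively (\<lambda>a b. b \<noteq> qcnj a) (c @ [y])"
    and "lin_prod (c @ [y]) \<otimes>\<^sub>q g \<in> right_ideal (char_poly e)"
  shows "g \<in> right_ideal (lin (qcnj y))"
  using assms
proof (induction c arbitrary: y g rule: rev_induct)
  case Nil
  then obtain q where "lin y \<otimes>\<^sub>q g = char_poly y \<otimes>\<^sub>q q" by (auto elim: right_idealE)
  then have "lin y \<otimes>\<^sub>q g = lin y \<otimes>\<^sub>q (lin (qcnj y) \<otimes>\<^sub>q q)"
    by (simp add: char_poly_def qpoly_mult_assoc)
  then have "g = lin (qcnj y) \<otimes>\<^sub>q q" by (simp add: qpoly_mult_left_cancel)
  then show ?case by auto
next
  case (snoc b c)
  let ?c = "c @ [b]" and ?r = "eval_left g (qcnj y)"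
  define h where "h = quot_left (qcnj y) g"
  have g: "g = [:?r:] + lin (qcnj y) \<otimes>\<^sub>q h" unfolding h_def by (rule lin_division)
  have y: "char_poly y = char_poly e" using snoc.prems(1) by simp
  \<comment> \<open>The multiple of \<open>lin (qcnj y)\<close> in \<open>g\<close> meets the last
    factor \<open>lin y\<close> and already lies in the ideal, so only the constant remainder is
    left to treat.\<close>
  have "lin_prod (?c @ [y]) \<otimes>\<^sub>q (lin (qcnj y) \<otimes>\<^sub>q h) = lin_prod ?c \<otimes>\<^sub>q (char_poly y \<otimes>\<^sub>q h)"
    unfolding lin_prod_append[of ?c] by (simp add: char_poly_def qpoly_mult_assoc)
  also have "\<dots> = char_poly e \<otimes>\<^sub>q (lin_prod ?c \<otimes>\<^sub>q h)"
    unfolding y by (rule char_poly_left_commute)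
  finally have "lin_prod (?c @ [y]) \<otimes>\<^sub>q (lin (qcnj y) \<otimes>\<^sub>q h) \<in> right_ideal (char_poly e)"
    by (simp only: right_idealI)
  moreover have "lin_prod (?c @ [y]) \<otimes>\<^sub>q [:?r:] =
      lin_prod (?c @ [y]) \<otimes>\<^sub>q g - lin_prod (?c @ [y]) \<otimes>\<^sub>q (lin (qcnj y) \<otimes>\<^sub>q h)"
    by (subst g) (simp only: qpoly_mult_distrib add_diff_cancel_right')
  ultimately have r: "lin_prod (?c @ [y]) \<otimes>\<^sub>q [:?r:] \<in> right_ideal (char_poly e)"
    using snoc.prems(3) by (simp only: right_ideal_diff)
  have "?r = 0"
  proof (rule ccontr)
    assume "?r \<noteq> 0"
    \<comment> \<open>A nonzero constant is invertible, so the chain product itself would lie in the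
      ideal.\<close>
    then have "[:?r:] \<otimes>\<^sub>q [:inverse ?r:] = [:1:]"
      by (simp add: pCons_qpoly_mult_const)
    then have "lin_prod (?c @ [y]) = lin_prod (?c @ [y]) \<otimes>\<^sub>q [:?r:] \<otimes>\<^sub>q [:inverse ?r:]"
      by (simp only: qpoly_mult_assoc qpoly_mult_simps)
    then have "lin_prod (?c @ [y]) \<in> right_ideal (char_poly e)"
      using right_ideal_mult[OF r] by metis
    then have "lin_prod ?c \<otimes>\<^sub>q lin y \<in> right_ideal (char_poly e)"
      unfolding lin_prod_append[of ?c] by simp
    moreover have "\<forall>a\<in>set ?c. char_poly a = char_poly e"
      "successively (\<lambda>a b. b \<noteq> qcnj a) ?c"
      using snoc.prems by (simp_all add: successively_append_iff)
    \<comment> \<open>The induction hypothesis for the shorter chain, with \<open>lin y\<close> as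
      cofactor, forces \<open>y = qcnj b\<close>, which the chain condition forbids.\<close>
    ultimately have "lin y \<in> right_ideal (lin (qcnj b))"
      using snoc.IH by blast
    then have "y = qcnj b" by (simp add: right_ideal_lin_iff)
    then show False using snoc.prems(2) by (simp add: successively_append_iff)
  qed
  then show ?case by (simp add: right_ideal_lin_iff)
qed

text \<open>Each power costs one factor: the last chain entry and its conjugate at the front of
  \<open>g\<close> form the central quadratic, which is cancelled, leaving a shorter chain and a
  smaller exponent.\<close>

lemma chain_mult_in_char_power_ideal:
  assumes "\<forall>a\<in>set c. char_poly a = char_poly e"
    and "successively (\<lambda>a b. b \<noteq> qcnj a) c" and "s \<le> length c"
    and "lin_prod c \<otimes>\<^sub>q g \<in> right_ideal (qpoly_power (char_poly e) s)"
  shows "g \<in> right_ideal (lin_prod (map qcnj (take s (rev c))))"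
  using assms
proof (induction s arbitrary: c g)
  case 0
  then show ?case using right_idealI[of "[:1:]" g] by simp
next
  case (Suc s)
  then obtain c' y where c: "c = c' @ [y]" by (metis Suc_le_length_iff length_rev rev_eq_Cons_iff)
  have y: "char_poly y = char_poly e" using Suc.prems(1) c by simp
  obtain k where k: "lin_prod c \<otimes>\<^sub>q g = char_poly e \<otimes>\<^sub>q (qpoly_power (char_poly e) s \<otimes>\<^sub>q k)"
    using Suc.prems(4) by (auto elim!: right_idealE simp: qpoly_mult_assoc)
  then have "lin_prod c \<otimes>\<^sub>q g \<in> right_ideal (char_poly e)" by (simp only: right_idealI)
  then have "g \<in> right_ideal (lin (qcnj y))"
    using chain_mult_in_char_ideal[of c' y e g] Suc.prems(1,2) unfolding c by blast
  then obtain h where h: "g = lin (qcnj y) \<otimes>\<^sub>q h" by (rule right_idealE)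
  have "char_poly e \<otimes>\<^sub>q (lin_prod c' \<otimes>\<^sub>q h) = lin_prod c' \<otimes>\<^sub>q (char_poly y \<otimes>\<^sub>q h)"
    unfolding y by (rule char_poly_left_commute[symmetric])
  also have "\<dots> = lin_prod c \<otimes>\<^sub>q g"
    by (simp add: c h char_poly_def qpoly_mult_assoc)
  finally have "lin_prod c' \<otimes>\<^sub>q h = qpoly_power (char_poly e) s \<otimes>\<^sub>q k"
    unfolding k by (simp add: qpoly_mult_left_cancel)
  then have "h \<in> right_ideal (lin_prod (map qcnj (take s (rev c'))))"
    using Suc.prems c by (intro Suc.IH) (auto simp: successively_append_iff)
  then show ?case by (simp add: c h right_ideal_mult_left_iff)
qed

lemma successively_conj_rev:
  "successively (\<lambda>a b. b \<noteq> qcnj a) (map qcnj (rev bs)) \<longleftrightarrow> successively (\<lambda>a b. b \<noteq> qcnj a) bs"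
proof -
  have "successively (\<lambda>a b. b \<noteq> qcnj a) (map qcnj (rev bs)) \<longleftrightarrow>
      successively (\<lambda>a b. qcnj a \<noteq> b) bs"
    by (simp add: successively_map)
  also have "\<dots> \<longleftrightarrow> successively (\<lambda>a b. b \<noteq> qcnj a) bs"
    by (intro successively_cong) auto
  finally show ?thesis .
qed

text \<open>Multiplying by the reversed conjugates of \<open>bs\<close> turns
  \<open>lin_prod bs\<close> into a central power, which reduces the condition to
  \<open>chain_mult_in_char_power_ideal\<close>.\<close>

lemma divergent_chains_ideal:
  assumes as: "\<forall>a\<in>set as. char_poly a = char_poly e" "successively (\<lambda>a b. b \<noteq> qcnj a) as"
    and bs: "\<forall>a\<in>set bs. char_poly a = char_poly e" "successively (\<lambda>a b. b \<noteq> qcnj a) bs"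
    and hd: "as \<noteq> [] \<Longrightarrow> bs \<noteq> [] \<Longrightarrow> hd as \<noteq> hd bs" and len: "length bs \<le> length as"
  shows "lin_prod as \<otimes>\<^sub>q g \<in> right_ideal (lin_prod bs) \<longleftrightarrow>
    g \<in> right_ideal (lin_prod (map qcnj (take (length bs) (rev as))))" (is "?l \<longleftrightarrow> ?r")
proof
  let ?bs = "map qcnj (rev bs)"
  assume ?l
  then obtain h where h: "lin_prod as \<otimes>\<^sub>q g = lin_prod bs \<otimes>\<^sub>q h" by (rule right_idealE)
  have bs': "\<forall>a\<in>set ?bs. char_poly a = char_poly e" using bs(1) by auto
  have "lin_prod (?bs @ as) \<otimes>\<^sub>q g = (lin_prod ?bs \<otimes>\<^sub>q lin_prod bs) \<otimes>\<^sub>q h"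
    by (simp add: qpoly_mult_assoc h)
  also have "lin_prod ?bs \<otimes>\<^sub>q lin_prod bs = qpoly_power (char_poly e) (length bs)"
    using lin_prod_mult_conj[OF bs'] by (simp add: rev_map comp_def)
  finally have "lin_prod (?bs @ as) \<otimes>\<^sub>q g \<in> right_ideal (qpoly_power (char_poly e) (length bs))"
    by (simp only: right_idealI)
  \<comment> \<open>At the junction the forbidden value is \<open>qcnj (qcnj (hd bs))\<close>, so
    differing heads are exactly what keeps the concatenation a chain.\<close>
  moreover have "successively (\<lambda>a b. b \<noteq> qcnj a) (?bs @ as)"
    unfolding successively_append_iff successively_conj_rev
    using as(2) bs(2) hd by (auto simp: last_map last_rev)
  ultimately have "g \<in> right_ideal (lin_prod (map qcnj (take (length bs) (rev (?bs @ as)))))"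
    using as(1) bs' by (intro chain_mult_in_char_power_ideal[of _ e]) auto
  then show ?r using len by simp
next
  assume ?r
  then obtain h where h: "g = lin_prod (map qcnj (take (length bs) (rev as))) \<otimes>\<^sub>q h"
    by (rule right_idealE)
  \<comment> \<open>For the converse, the last \<open>length bs\<close> factors of \<open>as\<close>
    meet their conjugates in \<open>g\<close>; the resulting central power can be moved to the front
    and rewritten as a multiple of \<open>lin_prod bs\<close>.\<close>
  define as1 as2 where "as1 = take (length as - length bs) as"
    and "as2 = drop (length as - length bs) as"
  have split: "as = as1 @ as2" by (simp add: as1_def as2_def)
  have as2: "take (length bs) (rev as) = rev as2" "length as2 = length bs"
    using len by (simp_all add: as2_def take_rev)
  have "lin_prod as \<otimes>\<^sub>q g = lin_prod as1 \<otimes>\<^sub>q (lin_prod as2 \<otimes>\<^sub>q lin_prod (map qcnj (rev as2))) \<otimes>\<^sub>q h"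
    unfolding h as2 by (simp add: split qpoly_mult_assoc)
  also have "lin_prod as2 \<otimes>\<^sub>q lin_prod (map qcnj (rev as2)) = qpoly_power (char_poly e) (length as2)"
    using as(1) by (intro lin_prod_mult_conj) (auto simp: split)
  also have "\<dots> = lin_prod bs \<otimes>\<^sub>q lin_prod (map qcnj (rev bs))"
    using lin_prod_mult_conj[OF bs(1)] as2 by simp
  also have "lin_prod as1 \<otimes>\<^sub>q \<dots> = \<dots> \<otimes>\<^sub>q lin_prod as1"
    unfolding lin_prod_mult_conj[OF bs(1)] by (rule char_poly_power_central[symmetric])
  finally show ?l by (simp add: qpoly_mult_assoc right_idealI)
qed

section \<open>Intersections over different conjugacy classes\<close>

text \<open>Comparing coefficients, this asks for a + b' = b + a' and a b' = b a'.\<close>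

lemma lin_swap:
  assumes "a \<noteq> b"
  obtains a' b' where "char_poly a' = char_poly a" "char_poly b' = char_poly b"
    "lin a \<otimes>\<^sub>q lin b' = lin b \<otimes>\<^sub>q lin a'"
proof
  \<comment> \<open>Conjugating both elements by their difference gives b' - a' = b - a at once,
    hence the equality of the sums.\<close>
  let ?c = "b - a"
  have c: "?c \<noteq> 0" using assms by simp
  let ?a = "inverse ?c * a * ?c" and ?b = "inverse ?c * b * ?c"
  show "char_poly ?a = char_poly a" "char_poly ?b = char_poly b"
    using c unfolding qsim_iff_char_poly[symmetric] qsim_def by blast+
  have "x * b * y - x * a * y = x * (b - a) * y" for x y by (simp add: algebra_simps)
  then have "?b - ?a = inverse ?c * (b - a) * ?c" .
  also have "\<dots> = ?c" using c by simp
  finally have sum: "a + ?b = b + ?a" by (simp add: algebra_simps)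
  \<comment> \<open>The identity behind the equality of the products; insert
    \<open>b = ?c + a\<close> on either side.\<close>
  have "a * inverse ?c * b = a * inverse ?c * (?c + a)" by simp
  also have "\<dots> = a + a * inverse ?c * a"
    by (simp only: distrib_left distrib_right mult.assoc left_inverse[OF c] mult_1_right)
  also have "\<dots> = (?c + a) * inverse ?c * a"
    by (simp only: distrib_right right_inverse[OF c] mult_1_left)
  also have "\<dots> = b * inverse ?c * a" by simp
  finally have prod: "a * ?b = b * ?a" by (simp flip: mult.assoc)
  have lin: "lin x \<otimes>\<^sub>q lin y = [:x * y, - (x + y), 1:]" for x y
    by (subst lin_mult) (simp add: const_qpoly_mult_pCons)
  show "lin a \<otimes>\<^sub>q lin ?b = lin b \<otimes>\<^sub>q lin ?a"
    unfolding lin sum prod ..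
qed

text \<open>Repeated \<open>lin_swap\<close> carries the factor \<open>b\<close> across the whole
  product. All class labels are kept, so the hypothesis survives each exchange.\<close>

lemma lin_prod_swap:
  assumes "\<forall>a\<in>set as. char_poly a \<noteq> char_poly b"
  shows "\<exists>b' as'. char_poly b' = char_poly b \<and> map char_poly as' = map char_poly as \<and>
    lin_prod (as @ [b']) = lin b \<otimes>\<^sub>q lin_prod as' \<and>
    (\<forall>h. lin_prod as \<otimes>\<^sub>q h \<in> right_ideal (lin b) \<longleftrightarrow> h \<in> right_ideal (lin b'))"
  using assms
proof (induction as arbitrary: b)
  case Nil
  show ?case by (intro exI[of _ b] exI[of _ "[]"]) simp
next
  case (Cons a as)
  have "a \<noteq> b" using Cons.prems by auto
  then obtain a1 b1 where 1: "char_poly a1 = char_poly a" "char_poly b1 = char_poly b"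
    "lin a \<otimes>\<^sub>q lin b1 = lin b \<otimes>\<^sub>q lin a1" by (rule lin_swap)
  have "\<forall>a\<in>set as. char_poly a \<noteq> char_poly b1" using Cons.prems 1(2) by simp
  from Cons.IH[OF this] obtain b' as' where IH: "char_poly b' = char_poly b1" "map char_poly as' = map char_poly as"
    "lin_prod (as @ [b']) = lin b1 \<otimes>\<^sub>q lin_prod as'"
    "\<And>h. lin_prod as \<otimes>\<^sub>q h \<in> right_ideal (lin b1) \<longleftrightarrow> h \<in> right_ideal (lin b')"
    by blast
  \<comment> \<open>Modulo \<open>lin b1\<close> only the constant remainder of \<open>h\<close>
    matters, and for a constant c the condition reads (b - a) c = 0.\<close>
  have lin: "lin a \<otimes>\<^sub>q h \<in> right_ideal (lin b) \<longleftrightarrow> h \<in> right_ideal (lin b1)" for h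
  proof
    assume "h \<in> right_ideal (lin b1)"
    then obtain k where "h = lin b1 \<otimes>\<^sub>q k" by (rule right_idealE)
    then have "lin a \<otimes>\<^sub>q h = lin b \<otimes>\<^sub>q (lin a1 \<otimes>\<^sub>q k)"
      by (simp only: 1(3) flip: qpoly_mult_assoc)
    then show "lin a \<otimes>\<^sub>q h \<in> right_ideal (lin b)" by (simp only: right_idealI)
  next
    assume h: "lin a \<otimes>\<^sub>q h \<in> right_ideal (lin b)"
    have "lin a \<otimes>\<^sub>q (lin b1 \<otimes>\<^sub>q quot_left b1 h) \<in> right_ideal (lin b)"
      unfolding qpoly_mult_assoc[symmetric] 1(3) by (simp only: qpoly_mult_assoc right_idealI)
    then have "lin a \<otimes>\<^sub>q h - lin a \<otimes>\<^sub>q (lin b1 \<otimes>\<^sub>q quot_left b1 h) \<in> right_ideal (lin b)"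
      using h by (simp only: right_ideal_diff)
    moreover have "h - lin b1 \<otimes>\<^sub>q quot_left b1 h = [:eval_left h b1:]"
      using lin_division[of h b1] by (simp only: diff_eq_eq)
    ultimately have "lin a \<otimes>\<^sub>q [:eval_left h b1:] \<in> right_ideal (lin b)"
      by (simp only: qpoly_mult_distrib(4)[symmetric])
    then have "(b - a) * eval_left h b1 = 0"
      by (simp add: right_ideal_lin_iff eval_left_mult_const)
    then show "h \<in> right_ideal (lin b1)" using \<open>a \<noteq> b\<close> by (simp add: right_ideal_lin_iff)
  qed
  have "lin_prod ((a # as) @ [b']) = lin a \<otimes>\<^sub>q lin_prod (as @ [b'])" by simp
  also have "\<dots> = (lin a \<otimes>\<^sub>q lin b1) \<otimes>\<^sub>q lin_prod as'" by (simp only: IH(3) qpoly_mult_assoc)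
  also have "\<dots> = lin b \<otimes>\<^sub>q lin_prod (a1 # as')" by (simp add: 1(3) qpoly_mult_assoc)
  finally have "lin_prod ((a # as) @ [b']) = lin b \<otimes>\<^sub>q lin_prod (a1 # as')" .
  then show ?case
    using 1 IH lin
    by (intro exI[of _ b'] exI[of _ "a1 # as'"]) (simp add: qpoly_mult_assoc)
qed

text \<open>The factors of \<open>bs\<close> are carried across \<open>as\<close> one by one. Each
  passage changes \<open>as\<close>, but not its labels, so the classes stay disjoint.\<close>

lemma disjoint_classes_ideal:
  assumes "\<forall>a\<in>set as. \<forall>b\<in>set bs. char_poly a \<noteq> char_poly b"
  shows "\<exists>bs'. map char_poly bs' = map char_poly bs \<and>
    (\<forall>h. lin_prod as \<otimes>\<^sub>q h \<in> right_ideal (lin_prod bs) \<longleftrightarrow> h \<in> right_ideal (lin_prod bs'))"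
  using assms
proof (induction bs arbitrary: as)
  case Nil
  have "f \<in> right_ideal [:1:]" for f using right_idealI[of "[:1:]" f] by simp
  then show ?case by (intro exI[of _ "[]"]) simp
next
  case (Cons b bs)
  obtain b' as' where b': "char_poly b' = char_poly b" "map char_poly as' = map char_poly as"
    "lin_prod (as @ [b']) = lin b \<otimes>\<^sub>q lin_prod as'"
    "\<And>h. lin_prod as \<otimes>\<^sub>q h \<in> right_ideal (lin b) \<longleftrightarrow> h \<in> right_ideal (lin b')"
    using lin_prod_swap[of as b] Cons.prems by auto
  have "char_poly ` set as' = char_poly ` set as" using arg_cong[OF b'(2), of set] by simp
  then have "\<forall>a\<in>set as'. \<forall>b\<in>set bs. char_poly a \<noteq> char_poly b"
    using Cons.prems by (metis (no_types, lifting) image_iff list.set_intros(2))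
  then obtain bs' where bs': "map char_poly bs' = map char_poly bs"
    "\<And>h. lin_prod as' \<otimes>\<^sub>q h \<in> right_ideal (lin_prod bs) \<longleftrightarrow> h \<in> right_ideal (lin_prod bs')"
    using Cons.IH by blast
  have "lin_prod as \<otimes>\<^sub>q h \<in> right_ideal (lin_prod (b # bs)) \<longleftrightarrow>
      h \<in> right_ideal (lin_prod (b' # bs'))" (is "?l \<longleftrightarrow> ?r") for h
  proof (cases "h \<in> right_ideal (lin b')")
    case True
    then obtain k where k: "h = lin b' \<otimes>\<^sub>q k" by (rule right_idealE)
    have "lin_prod as \<otimes>\<^sub>q h = lin_prod (as @ [b']) \<otimes>\<^sub>q k" by (simp add: k qpoly_mult_assoc)
    also have "\<dots> = lin b \<otimes>\<^sub>q (lin_prod as' \<otimes>\<^sub>q k)" by (simp only: b'(3) qpoly_mult_assoc)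
    finally have "?l \<longleftrightarrow> lin_prod as' \<otimes>\<^sub>q k \<in> right_ideal (lin_prod bs)"
      by (simp add: right_ideal_mult_left_iff)
    also have "\<dots> \<longleftrightarrow> ?r" by (simp add: bs'(2) k right_ideal_mult_left_iff)
    finally show ?thesis .
  next
    case False
    then have "\<not> ?l"
      using b'(4)[of h] by (auto elim!: right_idealE simp: qpoly_mult_assoc)
    moreover have "\<not> ?r" using False by (auto elim!: right_idealE simp: qpoly_mult_assoc)
    ultimately show ?thesis by simp
  qed
  then show ?case using b'(1) bs'(1) by (intro exI[of _ "b' # bs'"]) simp
qed

text \<open>\<open>x\<close> labels the classes. The clause on the labels of \<open>as\<close>
  carries the induction: it keeps the product built so far disjoint from the next class.\<close>

lemma ex_lin_prod_intersection:
  assumes "finite T" and "\<forall>S\<in>T. \<forall>a\<in>set (L S). char_poly a = x S" and "inj_on x T"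
  shows "\<exists>as. length as = (\<Sum>S\<in>T. length (L S)) \<and> char_poly ` set as \<subseteq> x ` T \<and>
    (\<forall>f. (\<forall>S\<in>T. f \<in> right_ideal (lin_prod (L S))) \<longleftrightarrow> f \<in> right_ideal (lin_prod as))"
  using assms
proof (induction T rule: finite_induct)
  case empty
  have "f \<in> right_ideal [:1:]" for f using right_idealI[of "[:1:]" f] by simp
  then show ?case by (intro exI[of _ "[]"]) simp
next
  case (insert S T)
  then obtain as where as: "length as = (\<Sum>S\<in>T. length (L S))" "char_poly ` set as \<subseteq> x ` T"
    "\<And>f. (\<forall>S\<in>T. f \<in> right_ideal (lin_prod (L S))) \<longleftrightarrow> f \<in> right_ideal (lin_prod as)"
    by auto
  have "x S \<notin> x ` T" using insert.prems(2) insert.hyps(2) by auto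
  moreover have LS: "char_poly b = x S" if "b \<in> set (L S)" for b
    using insert.prems(1) that by blast
  ultimately have "\<forall>a\<in>set as. \<forall>b\<in>set (L S). char_poly a \<noteq> char_poly b"
    using as(2) by (metis imageI subsetD)
  then obtain bs where bs: "map char_poly bs = map char_poly (L S)"
    "\<And>h. lin_prod as \<otimes>\<^sub>q h \<in> right_ideal (lin_prod (L S)) \<longleftrightarrow> h \<in> right_ideal (lin_prod bs)"
    using disjoint_classes_ideal[of as "L S"] by blast
  have "f \<in> right_ideal (lin_prod as) \<and> f \<in> right_ideal (lin_prod (L S)) \<longleftrightarrow>
      f \<in> right_ideal (lin_prod (as @ bs))" for f
  proof
    assume f: "f \<in> right_ideal (lin_prod as) \<and> f \<in> right_ideal (lin_prod (L S))"
    then obtain h where "f = lin_prod as \<otimes>\<^sub>q h" by (auto elim: right_idealE)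
    then show "f \<in> right_ideal (lin_prod (as @ bs))"
      using f bs(2) by (simp add: right_ideal_mult_left_iff)
  next
    assume "f \<in> right_ideal (lin_prod (as @ bs))"
    then obtain h where "f = lin_prod as \<otimes>\<^sub>q (lin_prod bs \<otimes>\<^sub>q h)"
      by (auto elim!: right_idealE simp: qpoly_mult_assoc)
    then show "f \<in> right_ideal (lin_prod as) \<and> f \<in> right_ideal (lin_prod (L S))"
      using bs(2) by auto
  qed
  moreover have "length bs = length (L S)" using arg_cong[OF bs(1), of length] by simp
  moreover have "char_poly ` set bs = char_poly ` set (L S)"
    using arg_cong[OF bs(1), of set] by simp
  then have "char_poly ` set (as @ bs) \<subseteq> x ` insert S T"
    using as(2) LS by (simp add: image_Un) blast
  ultimately show ?case
    using as(1,3) insert.hyps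
    by (intro exI[of _ "as @ bs"]) (simp add: conj_commute)
qed

section \<open>The ideal of a list of chains\<close>

lemma common_prefix_split:
  assumes "as \<noteq> []" "bs \<noteq> []"
  obtains p as' bs' where "as = p @ as'" "bs = p @ bs'" "length p = common_prefix as bs"
    "as' \<noteq> [] \<Longrightarrow> bs' \<noteq> [] \<Longrightarrow> hd as' \<noteq> hd bs'"
proof -
  define R where "R = {r. r \<le> length as \<and> r \<le> length bs \<and> (\<forall>x<r. bs ! x = as ! x)}"
  define r where "r = common_prefix as bs"
  have fin: "finite R" unfolding R_def by (rule finite_subset[of _ "{..length as}"]) auto
  have "0 \<in> R" by (simp add: R_def)
  have r: "r = Max R"
  proof (cases "bs ! 0 = as ! 0")
    case False
    \<comment> \<open>With different first entries only 0 lies in \<open>R\<close>, so the separate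
      case of \<open>common_prefix\<close> agrees with the maximum.\<close>
    then have "R \<subseteq> {0}" by (auto simp: R_def)
    then have "R = {0}" using \<open>0 \<in> R\<close> by auto
    then show ?thesis using False by (simp add: r_def common_prefix_def)
  qed (simp add: r_def common_prefix_def R_def)
  have "r \<in> R" unfolding r using fin \<open>0 \<in> R\<close> by (intro Max_in) auto
  then have rR: "r \<le> length as" "r \<le> length bs" "\<And>x. x < r \<Longrightarrow> bs ! x = as ! x"
    by (auto simp: R_def)
  \<comment> \<open>Maximality means that the lists differ at position \<open>r\<close>, unless one
    of them ends there.\<close>
  have "Suc r \<notin> R" using Max_ge[OF fin, of "Suc r"] r by auto
  then have ne: "as ! r \<noteq> bs ! r" if "r < length as" "r < length bs"
    using that rR(3) by (auto simp: R_def less_Suc_eq)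
  have take: "take r bs = take r as" using rR by (intro nth_equalityI) auto
  show thesis
  proof (rule that[of "take r as" "drop r as" "drop r bs"])
    show "bs = take r as @ drop r bs" by (metis take append_take_drop_id)
    show "hd (drop r as) \<noteq> hd (drop r bs)" if "drop r as \<noteq> []" "drop r bs \<noteq> []"
      using that ne by (simp add: hd_drop_conv_nth)
    show "length (take r as) = common_prefix as bs" using rR by (simp add: r_def)
  qed simp
qed

lemma spherical_chainD:
  assumes "spherical_chain as"
  shows "as \<noteq> []" "successively (\<lambda>a b. b \<noteq> qcnj a) as"
    "\<forall>a\<in>set as. char_poly a = char_poly (hd as)"
proof -
  have *: "successively (\<lambda>a b. char_poly a = char_poly b \<and> b \<noteq> qcnj a) as"
    using assms unfolding spherical_chain_def qsim_iff_char_poly by blast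
  show "as \<noteq> []" using assms by (simp add: spherical_chain_def)
  show "successively (\<lambda>a b. b \<noteq> qcnj a) as" using * by (rule successively_mono) (elim conjE, assumption)
  show "\<forall>a\<in>set as. char_poly a = char_poly (hd as)"
    using *
  proof (induction as rule: induct_list012)
    case (3 a b as)
    have ab: "char_poly a = char_poly b"
      "successively (\<lambda>a b. char_poly a = char_poly b \<and> b \<noteq> qcnj a) (b # as)"
      using "3.prems" by simp_all
    have "\<forall>c\<in>set (b # as). char_poly c = char_poly a"
      using "3.IH"(2)[OF ab(2)] unfolding list.sel ab(1) .
    then show ?case by simp
  qed simp_all
qed

lemma conj_classes_iff: "S \<in> conj_classes \<longleftrightarrow> (\<exists>e. S = {b. char_poly b = char_poly e})"
proof -
  have "{(a, b). qsim a b} `` {e} = {b. char_poly b = char_poly e}" for e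
    by (auto simp: qsim_iff_char_poly)
  then show ?thesis by (simp add: conj_classes_def quotient_def)
qed

text \<open>The common prefix is a common left factor and cancels; what remains are chains with
  different heads.\<close>

lemma two_chains_ideal:
  assumes as: "spherical_chain as" "\<forall>a\<in>set as. char_poly a = char_poly e"
    and bs: "spherical_chain bs" "\<forall>a\<in>set bs. char_poly a = char_poly e"
    and len: "length bs \<le> length as"
  shows "lin_prod as \<otimes>\<^sub>q g \<in> right_ideal (lin_prod bs) \<longleftrightarrow>
    g \<in> right_ideal (lin_prod (map qcnj (take (length bs - common_prefix as bs) (rev as))))"
proof -
  obtain p as' bs' where p: "as = p @ as'" "bs = p @ bs'" "length p = common_prefix as bs"
    "as' \<noteq> [] \<Longrightarrow> bs' \<noteq> [] \<Longrightarrow> hd as' \<noteq> hd bs'"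
    using common_prefix_split spherical_chainD(1) as(1) bs(1) by metis
  have "lin_prod as \<otimes>\<^sub>q g \<in> right_ideal (lin_prod bs) \<longleftrightarrow>
      lin_prod as' \<otimes>\<^sub>q g \<in> right_ideal (lin_prod bs')"
    by (simp add: p(1,2) qpoly_mult_assoc right_ideal_mult_left_iff)
  also have "\<dots> \<longleftrightarrow> g \<in> right_ideal (lin_prod (map qcnj (take (length bs') (rev as'))))"
    using as bs len p(4) spherical_chainD(2)[OF as(1)] spherical_chainD(2)[OF bs(1)]
    by (intro divergent_chains_ideal[of _ e]) (auto simp: p(1,2) successively_append_iff)
  \<comment> \<open>The rest of \<open>bs\<close> is no longer than the rest of \<open>as\<close>,
    so the entries taken never reach into the prefix.\<close>
  also have "take (length bs') (rev as') = take (length bs - common_prefix as bs) (rev as)"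
    using len unfolding p(3)[symmetric] by (simp add: p(1,2))
  finally show ?thesis .
qed

lemma longest_chain:
  assumes "chains_in cs S \<noteq> {}"
  shows "longest_chain cs S \<in> chains_in cs S"
    and "j \<in> chains_in cs S \<Longrightarrow> length (cs ! j) \<le> length (cs ! longest_chain cs S)"
proof -
  let ?I = "chains_in cs S"
  have fin: "finite ?I" by (simp add: chains_in_def)
  have "Max ((\<lambda>j. length (cs ! j)) ` ?I) \<in> (\<lambda>j. length (cs ! j)) ` ?I"
    using fin assms by (intro Max_in) auto
  then obtain i where i: "i \<in> ?I" "length (cs ! i) = Max ((\<lambda>j. length (cs ! j)) ` ?I)"
    by auto
  then have "\<exists>i. i \<in> ?I \<and> (\<forall>j\<in>?I. length (cs ! j) \<le> length (cs ! i))"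
    using fin by (intro exI[of _ i]) simp
  from someI_ex[OF this] show "longest_chain cs S \<in> ?I"
    "j \<in> ?I \<Longrightarrow> length (cs ! j) \<le> length (cs ! longest_chain cs S)"
    unfolding longest_chain_def by blast+
qed

lemma right_ideal_lin_prod_append:
  "f \<in> right_ideal (lin_prod (as @ bs)) \<Longrightarrow> f \<in> right_ideal (lin_prod as)"
  by (auto elim!: right_idealE simp: qpoly_mult_assoc)

text \<open>Unless there is only one chain, the generator is the longest chain followed by the
  conjugates of its last \<open>d\<close> entries in reverse order, where \<open>d\<close> is the
  maximum in \<open>chain_mu\<close>.\<close>

lemma class_ideal:
  assumes cs: "\<forall>as\<in>set cs. spherical_chain as"
    and S: "S = {b. char_poly b = char_poly e}" and ne: "chains_in cs S \<noteq> {}"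
  shows "\<exists>as. length as = chain_mu cs S \<and> (\<forall>a\<in>set as. char_poly a = char_poly e) \<and>
    (\<forall>f. (\<forall>j\<in>chains_in cs S. f \<in> right_ideal (lin_prod (cs ! j))) \<longleftrightarrow>
      f \<in> right_ideal (lin_prod as))"
proof -
  let ?I = "chains_in cs S"
  define i where "i = longest_chain cs S"
  have i: "i \<in> ?I" and len: "\<And>j. j \<in> ?I \<Longrightarrow> length (cs ! j) \<le> length (cs ! i)"
    using longest_chain[OF ne] by (simp_all add: i_def)
  have I: "spherical_chain (cs ! j)" "\<forall>a\<in>set (cs ! j). char_poly a = char_poly e" if "j \<in> ?I" for j
    using that cs by (auto simp: chains_in_def S)
  show ?thesis
  proof (cases "?I = {i}")
    case True
    then show ?thesis
      using I[OF i] by (intro exI[of _ "cs ! i"]) (simp add: chain_mu_def flip: i_def)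
  next
    case False
    let ?s = "\<lambda>j. length (cs ! j) - common_prefix (cs ! i) (cs ! j)"
    let ?J = "?I - {i}"
    define d where "d = Max (?s ` ?J)"
    have J: "finite (?s ` ?J)" "?s ` ?J \<noteq> {}" using False i by (auto simp: chains_in_def)
    have d: "d \<in> ?s ` ?J" unfolding d_def using J by (rule Max_in)
    have le_d: "?s j \<le> d" if "j \<in> ?J" for j
      unfolding d_def using J(1) that by (intro Max_ge) auto
    \<comment> \<open>Ensures that \<open>take d\<close> really yields \<open>d\<close> entries, so
      that the length of \<open>?L\<close> is \<open>chain_mu cs S\<close>.\<close>
    have "d \<le> length (cs ! i)" using d len by fastforce
    let ?t = "\<lambda>n. map qcnj (take n (rev (cs ! i)))"
    let ?L = "cs ! i @ ?t d"
    have "length ?L = chain_mu cs S"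
      using False \<open>d \<le> length (cs ! i)\<close>
      by (simp add: chain_mu_def d_def flip: i_def)
    moreover have "\<forall>a\<in>set ?L. char_poly a = char_poly e"
      using I(2)[OF i] by (auto dest: in_set_takeD)
    moreover have "(\<forall>j\<in>?I. f \<in> right_ideal (lin_prod (cs ! j))) \<longleftrightarrow> f \<in> right_ideal (lin_prod ?L)"
      (is "?l \<longleftrightarrow> ?r") for f
    proof -
      have "?l \<longleftrightarrow> f \<in> right_ideal (lin_prod (cs ! i)) \<and>
          (\<forall>j\<in>?J. f \<in> right_ideal (lin_prod (cs ! j)))" using i by blast
      also have "\<dots> \<longleftrightarrow> ?r"
      proof (cases "f \<in> right_ideal (lin_prod (cs ! i))")
        case True
        then obtain g where g: "f = lin_prod (cs ! i) \<otimes>\<^sub>q g" by (rule right_idealE)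
        have "f \<in> right_ideal (lin_prod (cs ! j)) \<longleftrightarrow> g \<in> right_ideal (lin_prod (?t (?s j)))"
          if "j \<in> ?J" for j
          unfolding g using that I I[OF i] len by (intro two_chains_ideal[of _ e]) auto
        then have "(\<forall>j\<in>?J. f \<in> right_ideal (lin_prod (cs ! j))) \<longleftrightarrow>
            (\<forall>j\<in>?J. g \<in> right_ideal (lin_prod (?t (?s j))))" by blast
        also have "\<dots> \<longleftrightarrow> g \<in> right_ideal (lin_prod (?t d))"
        proof
          assume "\<forall>j\<in>?J. g \<in> right_ideal (lin_prod (?t (?s j)))"
          then show "g \<in> right_ideal (lin_prod (?t d))" using d by blast
        next
          assume g: "g \<in> right_ideal (lin_prod (?t d))"
          show "\<forall>j\<in>?J. g \<in> right_ideal (lin_prod (?t (?s j)))"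
          proof
            fix j assume "j \<in> ?J"
            \<comment> \<open>Nestedness: the list for a smaller number of factors is a prefix of
              the one for \<open>d\<close>, so its condition is implied.\<close>
            then have "?t d = ?t (?s j) @ drop (?s j) (?t d)"
              using le_d[of j] append_take_drop_id[of "?s j" "?t d"]
              by (simp add: take_map min_absorb1)
            then show "g \<in> right_ideal (lin_prod (?t (?s j)))"
              using g right_ideal_lin_prod_append by metis
          qed
        qed
        also have "\<dots> \<longleftrightarrow> ?r" by (simp add: g right_ideal_mult_left_iff)
        finally show ?thesis using True by blast
      next
        case False
        then show ?thesis using right_ideal_lin_prod_append by blast
      qed
      finally show ?thesis .
    qed
    ultimately show ?thesis by blast
  qed
qed

text \<open>Each occupied class contributes one product of length \<open>chain_mu\<close>; distinct
  classes have distinct labels, so the lengths add up to \<open>chain_kappa\<close>.\<close>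

lemma chains_ideal:
  assumes cs: "\<forall>as\<in>set cs. spherical_chain as"
  obtains as where "length as = chain_kappa cs"
    "\<And>f. (\<forall>bs\<in>set cs. f \<in> right_ideal (lin_prod bs)) \<longleftrightarrow> f \<in> right_ideal (lin_prod as)"
proof -
  define T where "T = {S \<in> conj_classes. chains_in cs S \<noteq> {}}"
  \<comment> \<open>The class of the \<open>i\<close>-th chain. Every occupied class arises in this
    way, which makes the index set \<open>T\<close> finite.\<close>
  define cl where "cl i = {b. char_poly b = char_poly (hd (cs ! i))}" for i
  have in_cl: "i \<in> chains_in cs (cl i)" if "i < length cs" for i
  proof -
    have "set (cs ! i) \<subseteq> cl i"
      unfolding cl_def using that spherical_chainD(3)[of "cs ! i"] cs nth_mem by blast
    then show ?thesis using that by (simp add: chains_in_def)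
  qed
  have "T \<subseteq> cl ` {..<length cs}"
  proof
    fix S assume "S \<in> T"
    then obtain e i where e: "S = {b. char_poly b = char_poly e}" and i: "i \<in> chains_in cs S"
      by (auto simp: T_def conj_classes_iff)
    then have "i < length cs" "set (cs ! i) \<subseteq> S" by (auto simp: chains_in_def)
    moreover from this have "hd (cs ! i) \<in> S"
      using cs spherical_chainD(1)[of "cs ! i"] by auto
    then have "S = cl i" using e by (simp add: cl_def)
    ultimately show "S \<in> cl ` {..<length cs}" by simp
  qed
  then have fin: "finite T" by (rule finite_subset) simp
  have "\<forall>S\<in>T. \<exists>e. S = {b. char_poly b = char_poly e}"
    by (simp add: T_def conj_classes_iff)
  from bchoice[OF this] obtain E where
    E: "\<And>S. S \<in> T \<Longrightarrow> S = {b. char_poly b = char_poly (E S)}" by blast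
  have "\<forall>S\<in>T. \<exists>as. length as = chain_mu cs S \<and> (\<forall>a\<in>set as. char_poly a = char_poly (E S)) \<and>
    (\<forall>f. (\<forall>j\<in>chains_in cs S. f \<in> right_ideal (lin_prod (cs ! j))) \<longleftrightarrow>
      f \<in> right_ideal (lin_prod as))"
    using class_ideal[OF cs E] by (simp add: T_def)
  from bchoice[OF this] obtain L where L: "\<And>S. S \<in> T \<Longrightarrow> length (L S) = chain_mu cs S"
    "\<forall>S\<in>T. \<forall>a\<in>set (L S). char_poly a = char_poly (E S)"
    "\<And>S f. S \<in> T \<Longrightarrow> (\<forall>j\<in>chains_in cs S. f \<in> right_ideal (lin_prod (cs ! j))) \<longleftrightarrow>
      f \<in> right_ideal (lin_prod (L S))"
    by blast
  have "inj_on (\<lambda>S. char_poly (E S)) T"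
  proof (rule inj_onI)
    fix S S' assume S: "S \<in> T" "S' \<in> T" and eq: "char_poly (E S) = char_poly (E S')"
    have "S = {b. char_poly b = char_poly (E S)}" by (rule E[OF S(1)])
    also have "\<dots> = {b. char_poly b = char_poly (E S')}" by (simp only: eq)
    also have "\<dots> = S'" by (rule E[OF S(2), symmetric])
    finally show "S = S'" .
  qed
  then obtain as where as: "length as = (\<Sum>S\<in>T. length (L S))"
    "\<And>f. (\<forall>S\<in>T. f \<in> right_ideal (lin_prod (L S))) \<longleftrightarrow> f \<in> right_ideal (lin_prod as)"
    using ex_lin_prod_intersection[OF fin L(2)] by blast
  show thesis
  proof (rule that)
    show "length as = chain_kappa cs"
      using as(1) L(1) by (simp add: chain_kappa_def flip: T_def)
    fix f
    have "(\<forall>bs\<in>set cs. f \<in> right_ideal (lin_prod bs)) \<longleftrightarrow>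
        (\<forall>i<length cs. f \<in> right_ideal (lin_prod (cs ! i)))"
      by (auto simp: all_set_conv_all_nth)
    also have "\<dots> \<longleftrightarrow> (\<forall>S\<in>T. \<forall>j\<in>chains_in cs S. f \<in> right_ideal (lin_prod (cs ! j)))"
    proof
      assume r: "\<forall>S\<in>T. \<forall>j\<in>chains_in cs S. f \<in> right_ideal (lin_prod (cs ! j))"
      have "cl i \<in> T" if "i < length cs" for i
        using in_cl[OF that] by (auto simp: T_def conj_classes_iff cl_def)
      then show "\<forall>i<length cs. f \<in> right_ideal (lin_prod (cs ! i))" using r in_cl by blast
    qed (auto simp: chains_in_def)
    also have "\<dots> \<longleftrightarrow> f \<in> right_ideal (lin_prod as)" using L(3) as(2) by simp
    finally show "(\<forall>bs\<in>set cs. f \<in> right_ideal (lin_prod bs)) \<longleftrightarrow>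
      f \<in> right_ideal (lin_prod as)" .
  qed
qed

section \<open>Columns of the left confluent Vandermonde matrix\<close>

abbreviation vand_rows :: "nat \<Rightarrow> quat list list \<Rightarrow> quat vec list" where
  "vand_rows m cs \<equiv> concat (map (\<lambda>as. rows (vand_left1 m as)) cs)"

lemma rows_vand_left1:
  "rows (vand_left1 m as) =
    map (\<lambda>i. vec m (\<lambda>j. ddiff_left (take (Suc i) as) (monom 1 j))) [0..<length as]"
  by (auto simp: rows_def vand_left1_def)

lemma set_vand_rows:
  "set (vand_rows m cs) =
    {vec m (\<lambda>j. ddiff_left (take (Suc i) as) (monom 1 j)) | as i. as \<in> set cs \<and> i < length as}"
  by (simp add: rows_vand_left1) (auto, blast)

lemma vand_rows_carrier: "set (vand_rows m cs) \<subseteq> carrier_vec m"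
  unfolding set_vand_rows by auto

text \<open>The entries of \<open>x\<close> become the coefficients of a polynomial, which
  translates column relations into ideal membership.\<close>

lemma vand_rows_annihilate_iff:
  assumes "k \<le> m"
  shows "(\<forall>v\<in>set (vand_rows m cs). (\<Sum>i<k. v $ i * x i) = 0) \<longleftrightarrow>
    (\<forall>as\<in>set cs. (\<Sum>i<k. monom (x i) i) \<in> right_ideal (lin_prod as))"
proof -
  have "(\<Sum>i<k. vec m (\<lambda>j. ddiff_left bs (monom 1 j)) $ i * x i) =
      ddiff_left bs (\<Sum>i<k. monom (x i) i)" for bs
    unfolding ddiff_left_sum_monom using assms by (intro sum.cong) auto
  then show ?thesis unfolding set_vand_rows ddiff_left_eq_0_iff[symmetric] by fastforce
qed

lemma coeff_sum_monom: "coeff (\<Sum>i<k. monom (x i) i) n = (if n < k then x n else 0)"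
  by (simp add: coeff_sum)

text \<open>A relation would give a nonzero polynomial of degree below \<open>chain_kappa\<close> in
  an ideal whose generator has degree \<open>chain_kappa\<close>.\<close>

lemma vand_rows_columns_indep:
  assumes "\<forall>as\<in>set cs. spherical_chain as"
    and "\<forall>v\<in>set (vand_rows m cs). (\<Sum>i<min m (chain_kappa cs). v $ i * x i) = 0"
  shows "\<forall>i<min m (chain_kappa cs). x i = 0"
proof -
  let ?k = "min m (chain_kappa cs)"
  let ?f = "\<Sum>i<?k. monom (x i) i"
  obtain as where as: "length as = chain_kappa cs"
    "\<And>f. (\<forall>bs\<in>set cs. f \<in> right_ideal (lin_prod bs)) \<longleftrightarrow> f \<in> right_ideal (lin_prod as)"
    using chains_ideal[OF assms(1)] by blast
  have "?f \<in> right_ideal (lin_prod as)"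
    using assms(2) by (simp only: vand_rows_annihilate_iff min.cobounded1 as(2))
  moreover have "degree ?f < ?k" if "?f \<noteq> 0"
  proof -
    have "coeff ?f (degree ?f) \<noteq> 0" using that by simp
    then show ?thesis unfolding coeff_sum_monom by (simp split: if_splits)
  qed
  ultimately have "?f = 0" using degree_right_ideal[of ?f "lin_prod as"] as(1) by fastforce
  then show ?thesis using coeff_sum_monom[of x ?k] by (metis coeff_0)
qed

text \<open>For a later column, the remainder of z^j modulo the common generator supplies the
  coefficients.\<close>

lemma vand_rows_columns_span:
  assumes "\<forall>as\<in>set cs. spherical_chain as" and "j < m"
  shows "\<exists>x. \<forall>v\<in>set (vand_rows m cs). v $ j = (\<Sum>i<min m (chain_kappa cs). v $ i * x i)"
proof (cases "j < min m (chain_kappa cs)")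
  case True
  have "(\<Sum>i<min m (chain_kappa cs). v $ i * (if i = j then 1 else 0)) =
      (\<Sum>i<min m (chain_kappa cs). if i = j then v $ i else 0)" for v :: "quat vec"
    by (intro sum.cong) auto
  then show ?thesis using True by (intro exI[of _ "\<lambda>i. if i = j then 1 else 0"]) simp
next
  case False
  let ?k = "min m (chain_kappa cs)"
  have k: "?k = chain_kappa cs" using False assms(2) by simp
  obtain as where as: "length as = chain_kappa cs"
    "\<And>f. (\<forall>bs\<in>set cs. f \<in> right_ideal (lin_prod bs)) \<longleftrightarrow> f \<in> right_ideal (lin_prod as)"
    using chains_ideal[OF assms(1)] by blast
  obtain q r where qr: "monom 1 j = lin_prod as \<otimes>\<^sub>q q + r" "\<And>i. i \<ge> ?k \<Longrightarrow> coeff r i = 0"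
    using lin_prod_division[of "monom 1 j" as] as(1) k by auto
  \<comment> \<open>The coefficients of z^j minus the remainder; at \<open>j\<close> the remainder
    has coefficient 0 because \<open>?k \<le> j\<close>.\<close>
  let ?y = "\<lambda>i. if i = j then 1 else - coeff r i"
  have "(\<Sum>i<Suc j. monom (?y i) i) = monom 1 j - r"
  proof (rule poly_eqI)
    fix n
    show "coeff (\<Sum>i<Suc j. monom (?y i) i) n = coeff (monom 1 j - r) n"
      unfolding coeff_sum_monom using False qr(2)[of n] qr(2)[of j] by auto
  qed
  also have "\<dots> = lin_prod as \<otimes>\<^sub>q q" using qr(1) by simp
  finally have "(\<Sum>i<Suc j. monom (?y i) i) \<in> right_ideal (lin_prod as)"
    by (simp only: right_idealI)
  then have 0: "\<forall>v\<in>set (vand_rows m cs). (\<Sum>i<Suc j. v $ i * ?y i) = 0"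
    using assms(2) by (simp only: as(2) vand_rows_annihilate_iff Suc_leI)
  have "v $ j = (\<Sum>i<?k. v $ i * coeff r i)" if "v \<in> set (vand_rows m cs)" for v
  proof -
    have "(\<Sum>i<Suc j. v $ i * ?y i) = 0" using 0 that by blast
    then have "0 = (\<Sum>i<j. v $ i * ?y i) + v $ j" by simp
    also have "(\<Sum>i<j. v $ i * ?y i) = - (\<Sum>i<j. v $ i * coeff r i)"
      unfolding sum_negf[symmetric] by (intro sum.cong) auto
    also have "(\<Sum>i<j. v $ i * coeff r i) = (\<Sum>i<?k. v $ i * coeff r i)"
      using False qr(2) by (intro sum.mono_neutral_right) auto
    finally show ?thesis by (simp add: eq_neg_iff_add_eq_0 flip: add_eq_0_iff)
  qed
  then show ?thesis by blast
qed

lemma rank_vand_left: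
  assumes "\<forall>as\<in>set cs. spherical_chain as"
  shows "rank (vand_left m cs) = min m (chain_kappa cs)"
proof -
  have "rank (vand_left m cs) = left_span_dim m (set (vand_rows m cs))"
    using vand_rows_carrier[of m cs] by (simp add: rank_def vand_left_def)
  also have "\<dots> = min m (chain_kappa cs)"
    using vand_rows_columns_indep[OF assms] vand_rows_columns_span[OF assms] vand_rows_carrier
    by (intro left_span_dim_eq_columns) auto
  finally show ?thesis .
qed

section \<open>Conjugation exchanges left and right\<close>

lemma qcnj_0 [simp]: "qcnj 0 = 0" and qcnj_1 [simp]: "qcnj 1 = 1"
  by (simp_all add: quat_eq_iff)

lemma qcnj_eq_0_iff [simp]: "qcnj a = 0 \<longleftrightarrow> a = 0"
  using qcnj_eq_iff[of a 0] by simp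

lemma qcnj_minus: "qcnj (- a) = - qcnj a"
  by (simp add: quat_eq_iff)

lemma qcnj_sum: "qcnj (sum g A) = (\<Sum>x\<in>A. qcnj (g x))"
  by (induction A rule: infinite_finite_induct) (simp_all add: qcnj_add)

lemma qcnj_power: "qcnj (a ^ n) = qcnj a ^ n"
  by (induction n) (simp_all add: qcnj_mult power_commutes)

abbreviation pcnj :: "quat poly \<Rightarrow> quat poly" where "pcnj \<equiv> map_poly qcnj"

lemma coeff_pcnj [simp]: "coeff (pcnj f) n = qcnj (coeff f n)"
  by (simp add: coeff_map_poly)

lemma pcnj_pcnj [simp]: "pcnj (pcnj f) = f"
  by (rule poly_eqI) simp

lemma pcnj_add: "pcnj (f + g) = pcnj f + pcnj g"
  by (rule poly_eqI) (simp add: qcnj_add)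

lemma pcnj_mult: "pcnj (f \<otimes>\<^sub>q g) = pcnj g \<otimes>\<^sub>q pcnj f"
proof (rule poly_eqI)
  fix n
  have "coeff (pcnj (f \<otimes>\<^sub>q g)) n = (\<Sum>i\<le>n. qcnj (coeff g (n - i)) * qcnj (coeff f i))"
    by (simp add: coeff_qpoly_mult qcnj_sum qcnj_mult)
  also have "\<dots> = (\<Sum>i\<le>n. qcnj (coeff g i) * qcnj (coeff f (n - i)))"
    using sum.atLeastAtMost_rev[of "\<lambda>i. qcnj (coeff g (n - i)) * qcnj (coeff f i)" 0 n]
    by (simp add: atMost_atLeast0)
  finally show "coeff (pcnj (f \<otimes>\<^sub>q g)) n = coeff (pcnj g \<otimes>\<^sub>q pcnj f) n"
    by (simp add: coeff_qpoly_mult)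
qed

lemma pcnj_pCons: "pcnj (pCons a f) = pCons (qcnj a) (pcnj f)"
  by (rule poly_eqI) (simp add: coeff_pCons split: nat.splits)

lemma eval_right_conj: "eval_right f a = qcnj (eval_left (pcnj f) (qcnj a))"
proof -
  have "degree (pcnj f) = degree f" by (rule degree_map_poly) simp
  then show ?thesis
    by (simp add: eval_right_def eval_left_def qcnj_sum qcnj_mult qcnj_power)
qed

text \<open>Coefficientwise conjugation reverses products, so right division by z - a becomes left
  division by the conjugate factor, whose quotient is unique.\<close>

lemma quot_right_conj: "quot_right a f = pcnj (quot_left (qcnj a) (pcnj f))"
proof -
  have "f = [:eval_right f a:] + g \<otimes>\<^sub>q lin a \<longleftrightarrow> g = pcnj (quot_left (qcnj a) (pcnj f))" for g
  proof -
    have inj: "pcnj p = pcnj q \<longleftrightarrow> p = q" for p q by (metis pcnj_pcnj)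
    have "f = [:eval_right f a:] + g \<otimes>\<^sub>q lin a \<longleftrightarrow>
        pcnj f = pcnj ([:eval_right f a:] + g \<otimes>\<^sub>q lin a)" by (rule inj[symmetric])
    also have "pcnj ([:eval_right f a:] + g \<otimes>\<^sub>q lin a) =
        [:eval_left (pcnj f) (qcnj a):] + lin (qcnj a) \<otimes>\<^sub>q pcnj g"
      by (simp add: pcnj_add pcnj_mult pcnj_pCons eval_right_conj qcnj_minus)
    also have "pcnj f = \<dots> \<longleftrightarrow> pcnj g = quot_left (qcnj a) (pcnj f)"
      using lin_division_unique(2) lin_division by metis
    also have "\<dots> \<longleftrightarrow> g = pcnj (quot_left (qcnj a) (pcnj f))" by (metis pcnj_pcnj)
    finally show ?thesis .
  qed
  then show ?thesis unfolding quot_right_def by simp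
qed

lemma ddiff_right_conj:
  assumes "as \<noteq> []"
  shows "ddiff_right as f = qcnj (ddiff_left (map qcnj as) (pcnj f))"
proof -
  have "fold quot_right bs f = pcnj (fold quot_left (map qcnj bs) (pcnj f))" for bs
    by (induction bs arbitrary: f) (simp_all add: quot_right_conj)
  then show ?thesis
    using assms by (simp add: ddiff_right_def ddiff_left_def eval_right_conj last_map map_butlast)
qed

lemma cols_vand_right1:
  "cols (vand_right1 m as) = map (map_vec qcnj) (rows (vand_left1 m (map qcnj as)))"
proof -
  have "ddiff_right (take (Suc j) as) (monom 1 i) =
      qcnj (ddiff_left (take (Suc j) (map qcnj as)) (monom 1 i))" if "j < length as" for i j
    using that by (subst ddiff_right_conj) (auto simp: take_map map_poly_monom)
  then show ?thesis by (auto simp: cols_def vand_right1_def rows_vand_left1)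
qed

section \<open>Invariance of the chains' combinatorial data under conjugation\<close>

lemma common_prefix_conj:
  assumes "as \<noteq> []" "bs \<noteq> []"
  shows "common_prefix (map qcnj as) (map qcnj bs) = common_prefix as bs"
proof -
  have "(r \<le> length as \<and> r \<le> length bs \<and> (\<forall>x<r. map qcnj bs ! x = map qcnj as ! x)) \<longleftrightarrow>
      (r \<le> length as \<and> r \<le> length bs \<and> (\<forall>x<r. bs ! x = as ! x))" for r
    by auto
  \<comment> \<open>Nonemptiness matters for the comparison at position 0, since \<open>map\<close>
    commutes with indexing only inside the list.\<close>
  then show ?thesis using assms by (simp add: common_prefix_def)
qed

text \<open>A quaternion and its conjugate have the same \<open>char_poly\<close>, so conjugation
  preserves every class, and it keeps lengths and common prefixes.\<close>

lemma chain_kappa_conj: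
  assumes cs: "\<forall>as\<in>set cs. spherical_chain as"
  shows "chain_kappa (map (map qcnj) cs) = chain_kappa cs"
proof -
  let ?cs = "map (map qcnj) cs"
  have chains: "chains_in ?cs S = chains_in cs S" if "S \<in> conj_classes" for S
  proof -
    have "qcnj ` A \<subseteq> S \<longleftrightarrow> A \<subseteq> S" for A
      using that by (auto simp: conj_classes_iff image_subset_iff subset_eq)
    then show ?thesis by (simp add: chains_in_def cong: conj_cong)
  qed
  have "chain_mu ?cs S = chain_mu cs S" if S: "S \<in> conj_classes" "chains_in cs S \<noteq> {}" for S
  proof -
    have len: "length (?cs ! j) = length (cs ! j)" if "j \<in> chains_in cs S" for j
      using that by (simp add: chains_in_def)
    \<comment> \<open>Both choices range over the same predicate on positions, so they pick the same
      index.\<close>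
    have longest: "longest_chain ?cs S = longest_chain cs S"
      unfolding longest_chain_def chains[OF S(1)] using len by (metis (no_types, lifting))
    have "common_prefix (?cs ! i) (?cs ! j) = common_prefix (cs ! i) (cs ! j)"
      if "i \<in> chains_in cs S" "j \<in> chains_in cs S" for i j
      using that cs spherical_chainD(1) by (auto simp: chains_in_def intro!: common_prefix_conj)
    then show ?thesis
      using longest_chain(1)[OF S(2)] len
      by (simp add: chain_mu_def Let_def longest chains[OF S(1)] cong: image_cong_simp)
  qed
  then show ?thesis unfolding chain_kappa_def using chains by (intro sum.cong) auto
qed

lemma spherical_chain_conj: "spherical_chain as \<Longrightarrow> spherical_chain (map qcnj as)"
  unfolding spherical_chain_def qsim_iff_char_poly successively_map
  by (auto intro: successively_mono[where P = "\<lambda>a b. char_poly a = char_poly b \<and> b \<noteq> qcnj a"])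

text \<open>The rows of the right matrix are the conjugated columns of the left matrix for the
  conjugate chains. Conjugation turns right relations among those columns into left relations among
  these rows.\<close>

lemma rank_vand_right:
  assumes cs: "\<forall>as\<in>set cs. spherical_chain as"
  shows "rank (vand_right m cs) = min m (chain_kappa cs)"
proof -
  let ?cs = "map (map qcnj) cs" and ?k = "min m (chain_kappa cs)"
  let ?E = "vand_rows m ?cs"
  let ?n = "length ?E"
  have cs': "\<forall>as\<in>set ?cs. spherical_chain as" using cs spherical_chain_conj by auto
  note indep = vand_rows_columns_indep[OF cs', of m, unfolded chain_kappa_conj[OF cs]]
  note span = vand_rows_columns_span[OF cs', of _ m, unfolded chain_kappa_conj[OF cs]]
  have cols: "concat (map (\<lambda>as. cols (vand_right1 m as)) cs) = map (map_vec qcnj) ?E"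
    by (simp add: cols_vand_right1 map_concat comp_def)
  define r where "r i = vec ?n (\<lambda>c. qcnj (?E ! c $ i))" for i
  have E: "dim_vec (?E ! c) = m" if "c < ?n" for c
    using vand_rows_carrier[of m ?cs] nth_mem[OF that] by auto
  have row: "row (vand_right m cs) i = r i" if "i < m" for i
    using that E by (intro eq_vecI) (auto simp: vand_right_def cols mat_of_cols_def r_def)
  have dim: "dim_row (vand_right m cs) = m" "dim_col (vand_right m cs) = ?n"
    by (simp_all add: vand_right_def cols)
  have rows: "set (rows (vand_right m cs)) = r ` {..<m}"
    using row by (auto simp: rows_def dim atLeast0LessThan)
  have sum: "(\<Sum>i<?k. x i * r i $ c) = qcnj (\<Sum>i<?k. ?E ! c $ i * qcnj (x i))"
    if "c < ?n" for x c
    using that by (simp add: r_def qcnj_sum qcnj_mult)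
  have "left_span_dim ?n (r ` {..<m}) = ?k"
  proof (rule left_span_dim_eq_rows)
    show "r ` {..<m} \<subseteq> carrier_vec ?n" by (auto simp: r_def)
    show "r i \<in> r ` {..<m}" if "i < ?k" for i using that by simp
    fix x assume x: "\<forall>c<?n. (\<Sum>i<?k. x i * r i $ c) = 0"
    have "(\<Sum>i<?k. ?E ! c $ i * qcnj (x i)) = 0" if c: "c < ?n" for c
    proof -
      have "(\<Sum>i<?k. x i * r i $ c) = 0" using x c by blast
      then show ?thesis unfolding sum[OF c] by (simp only: qcnj_eq_0_iff)
    qed
    then have "\<forall>v\<in>set ?E. (\<Sum>i<?k. v $ i * qcnj (x i)) = 0"
      unfolding all_set_conv_all_nth by blast
    from indep[OF this] show "\<forall>i<?k. x i = 0" by simp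
  next
    fix v assume "v \<in> r ` {..<m}"
    then obtain j where j: "j < m" "v = r j" by auto
    obtain y where y: "\<forall>v\<in>set ?E. v $ j = (\<Sum>i<?k. v $ i * y i)"
      using span[OF j(1)] by blast
    have "v $ c = (\<Sum>i<?k. qcnj (y i) * r i $ c)" if "c < ?n" for c
    proof -
      have "v $ c = qcnj (?E ! c $ j)" using that by (simp add: j(2) r_def)
      also have "?E ! c $ j = (\<Sum>i<?k. ?E ! c $ i * y i)" using y nth_mem[OF that] by blast
      finally show ?thesis unfolding sum[OF that] qcnj_qcnj .
    qed
    then show "\<exists>x. \<forall>c<?n. v $ c = (\<Sum>i<?k. x i * r i $ c)"
      by (intro exI[of _ "\<lambda>i. qcnj (y i)"]) simp
  qed simp
  then show ?thesis by (simp add: rank_def dim rows)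
qed

theorem theorem1p7:
  fixes cs :: "quat list list" and m :: nat
  assumes "\<forall>as\<in>set cs. spherical_chain as"
  shows "rank (vand_left m cs) = min m (chain_kappa cs)
    \<and> min m (chain_kappa cs) = rank (vand_right m cs)"
  using rank_vand_left[OF assms] rank_vand_right[OF assms] by simp

end
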